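(* Let $0<|q|<1$, and let $(\alpha_n(a,k),\beta_n(a,k))_{n\ge 0}$ be a WP-Bailey pair. Let $a$ and $b$ be complex numbers such that all of the derived WP-Bailey pairs $(\alpha_n^*(c),\beta_n^*(c))_{n\ge1}$ for $c\in\{\pm a,\pm b,\pm 1/a,\pm 1/b\}$ exist, and suppose further that each of the series $f_2(a,q)$, $f_2(b,q)$, $f_2(1/a,q)$, $f_2(1/b,q)$ converges, where $$f_2(c,q):=\sum_{n=1}^{\infty} c^{2n}q^n\beta_n^*(c)-\sum_{n=1}^{\infty} c^{2n}q^n\beta_n^*(-c)+\sum_{n=1}^{\infty}\frac{(q;q)_{2n-1}}{(qc^2;q)_{2n}}c^{2n}q^n\alpha_n^*(-c)-\sum_{n=1}^{\infty}\frac{(q;q)_{2n-1}}{(qc^2;q)_{2n}}c^{2n}q^n\alpha_n^*(c).$$ Then $$f_2(a,q)-f_2(b,q)-f_2(1/a,q)+f_2(1/b,q)=\frac{2(a-b)(1+ab)}{(1-a^2)(1-b^2)}-2a\frac{(b/a,qa/b,-ab,-q/ab;q)_\infty(q^2,q^2;q^2)_\infty}{(a^2,q^2/a^2,b^2,q^2/b^2;q^2)_\infty}.$$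
   Context: Notation: $(x;q)_n=\prod_{j=0}^{n-1}(1-xq^j)$, $(x;q)_\infty=\prod_{j\ge0}(1-xq^j)$, and $(x_1,\dots,x_m;q)_n=(x_1;q)_n\cdots(x_m;q)_n$ (similarly for $n=\infty$). A WP-Bailey pair is a pair of sequences $(\alpha_n(a,k),\beta_n(a,k))_{n\ge0}$ (depending on parameters $a,k$ and $q$) with $\alpha_0=\beta_0=1$ and, for all $n\ge0$, $$\beta_n(a,k)=\sum_{j=0}^n\frac{(k/a;q)_{n-j}(k;q)_{n+j}}{(q;q)_{n-j}(aq;q)_{n+j}}\alpha_j(a,k).$$ The derived WP-Bailey pair is defined for $n\ge1$ by $\alpha_n^*(a)=\lim_{k\to1}\alpha_n(a,k)$ and $\beta_n^*(a)=\lim_{k\to1}\frac{\beta_n(a,k)}{1-k}$, when these limits exist. *)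

theory Defs
  imports "HOL-Analysis.Analysis"
begin

definition qpoch :: "complex \<Rightarrow> complex \<Rightarrow> nat \<Rightarrow> complex" where
  "qpoch x q n = (\<Prod>j<n. 1 - x * q ^ j)"

definition qpoch_inf :: "complex \<Rightarrow> complex \<Rightarrow> complex" where
  "qpoch_inf x q = (\<Prod>j. 1 - x * q ^ j)"

definition qpochs_inf :: "complex list \<Rightarrow> complex \<Rightarrow> complex" where
  "qpochs_inf xs q = (\<Prod>x\<leftarrow>xs. qpoch_inf x q)"

(* The pair is taken at fixed parameters a and k. The relation is meaningful only for
   a \<noteq> 0 and a * q ^ m \<noteq> 1 (m \<ge> 1); statements using it have to ensure this. *)
definition wp_bailey_pair ::
    "complex \<Rightarrow> complex \<Rightarrow> complex \<Rightarrow> (nat \<Rightarrow> complex) \<Rightarrow> (nat \<Rightarrow> complex) \<Rightarrow> bool" where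
  "wp_bailey_pair q a k \<alpha> \<beta> \<longleftrightarrow>
     \<alpha> 0 = 1 \<and> \<beta> 0 = 1 \<and>
     (\<forall>n. \<beta> n = (\<Sum>j\<le>n. qpoch (k / a) q (n - j) * qpoch k q (n + j) /
                       (qpoch q q (n - j) * qpoch (a * q) q (n + j)) * \<alpha> j))"

(* In a family, \<alpha> n a k stands for \<alpha>\<^sub>n(a,k), and likewise \<beta> n a k. *)
type_synonym wp_family = "nat \<Rightarrow> complex \<Rightarrow> complex \<Rightarrow> complex"

definition derived_alpha :: "wp_family \<Rightarrow> nat \<Rightarrow> complex \<Rightarrow> complex" where
  "derived_alpha \<alpha> n a = Lim (at 1) (\<lambda>k. \<alpha> n a k)"

definition derived_beta :: "wp_family \<Rightarrow> nat \<Rightarrow> complex \<Rightarrow> complex" where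
  "derived_beta \<beta> n a = Lim (at 1) (\<lambda>k. \<beta> n a k / (1 - k))"

definition derived_pair_exists :: "wp_family \<Rightarrow> wp_family \<Rightarrow> complex \<Rightarrow> bool" where
  "derived_pair_exists \<alpha> \<beta> a \<longleftrightarrow>
     (\<forall>n\<ge>1. (\<exists>l. ((\<lambda>k. \<alpha> n a k) \<longlongrightarrow> l) (at 1)) \<and>
            (\<exists>l. ((\<lambda>k. \<beta> n a k / (1 - k)) \<longlongrightarrow> l) (at 1)))"

(* The general terms of the series defining f2 at c, with the derived pair evaluated at
   d = c or d = - c. *)
definition f2_beta_term :: "complex \<Rightarrow> wp_family \<Rightarrow> complex \<Rightarrow> complex \<Rightarrow> nat \<Rightarrow> complex" where
  "f2_beta_term q \<beta> c d n = c ^ (2 * n) * q ^ n * derived_beta \<beta> n d"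

definition f2_alpha_term :: "complex \<Rightarrow> wp_family \<Rightarrow> complex \<Rightarrow> complex \<Rightarrow> nat \<Rightarrow> complex" where
  "f2_alpha_term q \<alpha> c d n =
     qpoch q q (2 * n - 1) / qpoch (q * c\<^sup>2) q (2 * n) * c ^ (2 * n) * q ^ n * derived_alpha \<alpha> n d"

(* The sums start at n = 1, hence the index Suc n. *)
definition f2 :: "complex \<Rightarrow> wp_family \<Rightarrow> wp_family \<Rightarrow> complex \<Rightarrow> complex" where
  "f2 q \<alpha> \<beta> c =
     (\<Sum>n. f2_beta_term q \<beta> c c (Suc n)) - (\<Sum>n. f2_beta_term q \<beta> c (- c) (Suc n))
     + (\<Sum>n. f2_alpha_term q \<alpha> c (- c) (Suc n)) - (\<Sum>n. f2_alpha_term q \<alpha> c c (Suc n))"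

(* Ordinary, possibly conditional, convergence of each of the four series. *)
definition f2_converges :: "complex \<Rightarrow> wp_family \<Rightarrow> wp_family \<Rightarrow> complex \<Rightarrow> bool" where
  "f2_converges q \<alpha> \<beta> c \<longleftrightarrow>
     summable (\<lambda>n. f2_beta_term q \<beta> c c (Suc n)) \<and>
     summable (\<lambda>n. f2_beta_term q \<beta> c (- c) (Suc n)) \<and>
     summable (\<lambda>n. f2_alpha_term q \<alpha> c (- c) (Suc n)) \<and>
     summable (\<lambda>n. f2_alpha_term q \<alpha> c c (Suc n))"

end

theory Submission
  imports Defs "HOL-Complex_Analysis.Complex_Analysis"
begin

text \<open>
  Letting \<open>k \<rightarrow> 1\<close> gives \<open>\<beta>\<^sub>n\<^sup>*(c) = \<Sum>j\<le>n. K(n,j) \<alpha>\<^sub>j\<^sup>*(c)\<close>, where \<open>\<alpha>\<^sub>0\<^sup>* = 1\<close>. Summing against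
  \<open>z\<^sup>n\<close>, \<open>z = c\<^sup>2 q\<close>, the inner series are evaluated by the \<open>q\<close>-Gauss sum, which produces the weights of
  the \<open>\<alpha>\<close>-series; the term \<open>j = 0\<close> contributes \<open>L(c\<^sup>2 q) - L(c q)\<close> with the Lambert series
  \<open>L(w) = \<Sum>j. w q\<^sup>j / (1 - w q\<^sup>j)\<close>. Hence \<open>f\<^sub>2(c) = L(-c q) - L(c q) = - 2 (\<Sum>j\<ge>1. c q\<^sup>j / (1 - c\<^sup>2 q\<^sup>2\<^sup>j))\<close>.

  Convergence of the series in \<open>f\<^sub>2\<close> does not force \<open>norm z < 1\<close>, so the exchange of summations needs a
  summability argument: it is performed after a Cauchy product with the coefficients of \<open>(x;q)\<^sub>\<infinity>\<close>.

  Then \<open>f\<^sub>2(a) - f\<^sub>2(1/a)\<close> is, up to an elementary term, a bilateral series \<open>P(a)\<close> invariant under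
  \<open>a \<mapsto> a q\<close>. Both \<open>P(a) - P(b)\<close> and the theta quotient are \<open>q\<close>-periodic with the same simple poles and
  residues at \<open>a = \<plusminus>1\<close>, so their difference is constant by the maximum modulus principle on an annulus,
  and it vanishes at \<open>a = b\<close>.
\<close>

section \<open>\<open>q\<close>-Pochhammer symbols and the \<open>q\<close>-binomial theorem\<close>

lemma qpoch_0 [simp]: "qpoch x q 0 = 1"
  by (simp add: qpoch_def)

lemma qpoch_Suc: "qpoch x q (Suc n) = qpoch x q n * (1 - x * q ^ n)"
  by (simp add: qpoch_def)

lemma qpoch_add: "qpoch x q (m + n) = qpoch x q m * qpoch (x * q ^ m) q n"
  by (induction n) (simp_all add: qpoch_Suc power_add mult.assoc)

lemma qpoch_eq_0_iff: "qpoch x q n = 0 \<longleftrightarrow> (\<exists>j<n. x * q ^ j = 1)"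
  by (auto simp: qpoch_def)

context
  fixes q :: complex
  assumes q: "norm q < 1"
begin

lemma qpoch_base_nonzero: "qpoch q q n \<noteq> 0"
proof -
  have "norm (q * q ^ j) < 1" for j
    using q power_Suc_less_one[of "norm q" j] by (cases "q = 0") (auto simp: norm_mult norm_power)
  hence "q * q ^ j \<noteq> 1" for j
    by (metis norm_one order_less_irrefl)
  thus ?thesis
    by (auto simp: qpoch_eq_0_iff)
qed

lemma sum_norm_power_le: "(\<Sum>j<n. norm (x * q ^ j)) \<le> norm x / (1 - norm q)"
proof -
  have s: "summable (\<lambda>j. norm q ^ j)"
    using q by (intro summable_geometric) auto
  have "(\<Sum>j<n. norm q ^ j) \<le> (\<Sum>j. norm q ^ j)"
    by (intro sum_le_suminf s) auto
  also have "\<dots> = 1 / (1 - norm q)"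
    using q by (intro suminf_geometric) auto
  finally have "norm x * (\<Sum>j<n. norm q ^ j) \<le> norm x * (1 / (1 - norm q))"
    by (intro mult_left_mono) auto
  thus ?thesis
    by (simp add: sum_distrib_left norm_mult norm_power)
qed

text \<open>The bound \<open>1 + t \<le> exp t\<close> on each factor gives an estimate uniform in
  \<open>n\<close>, which therefore passes to the infinite product.\<close>

lemma norm_qpoch_diff_1_le: "norm (qpoch x q n - 1) \<le> exp (norm x / (1 - norm q)) - 1"
proof -
  have "norm (qpoch x q n - 1) = norm ((\<Prod>j<n. 1 + (- (x * q ^ j))) - 1)"
    by (simp add: qpoch_def)
  also have "\<dots> \<le> (\<Prod>j<n. 1 + norm (- (x * q ^ j))) - 1"
    by (rule norm_prod_minus1_le_prod_minus1)
  also have "(\<Prod>j<n. 1 + norm (- (x * q ^ j))) \<le> exp (\<Sum>j<n. norm (- (x * q ^ j)))"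
    by (rule prod_le_exp_sum) auto
  also have "\<dots> \<le> exp (norm x / (1 - norm q))"
    using sum_norm_power_le[of x n] by simp
  finally show ?thesis by simp
qed

lemma norm_qpoch_le: "norm (qpoch x q n) \<le> exp (norm x / (1 - norm q))"
  using norm_qpoch_diff_1_le[of x n] norm_triangle_sub[of "qpoch x q n" 1] by simp

lemma convergent_prod_qpoch: "convergent_prod (\<lambda>j. 1 - x * q ^ j)"
proof -
  have "summable (\<lambda>j. norm x * norm q ^ j)"
    using q by (intro summable_mult summable_geometric) auto
  hence "abs_convergent_prod (\<lambda>j. 1 - x * q ^ j)"
    by (simp add: abs_convergent_prod_conv_summable norm_mult norm_power)
  thus ?thesis
    by (rule abs_convergent_prod_imp_convergent_prod)
qed

lemma qpoch_tendsto: "(\<lambda>n. qpoch x q n) \<longlonglongrightarrow> qpoch_inf x q"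
proof -
  have "(\<lambda>n. \<Prod>j\<le>n. 1 - x * q ^ j) \<longlonglongrightarrow> qpoch_inf x q"
    unfolding qpoch_inf_def by (rule convergent_prod_LIMSEQ[OF convergent_prod_qpoch])
  hence "(\<lambda>n. qpoch x q (Suc n)) \<longlonglongrightarrow> qpoch_inf x q"
    by (simp add: qpoch_def lessThan_Suc_atMost)
  thus ?thesis
    by (rule LIMSEQ_imp_Suc)
qed

lemma qpoch_inf_split: "qpoch_inf x q = qpoch x q n * qpoch_inf (x * q ^ n) q"
proof (rule LIMSEQ_unique)
  show "(\<lambda>m. qpoch x q (m + n)) \<longlonglongrightarrow> qpoch_inf x q"
    by (rule LIMSEQ_ignore_initial_segment[OF qpoch_tendsto])
  show "(\<lambda>m. qpoch x q (m + n)) \<longlonglongrightarrow> qpoch x q n * qpoch_inf (x * q ^ n) q"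
    unfolding add.commute[of _ n] qpoch_add by (intro tendsto_intros qpoch_tendsto)
qed

lemma qpoch_inf_rec: "qpoch_inf x q = (1 - x) * qpoch_inf (x * q) q"
  using qpoch_inf_split[of x 1] by (simp add: qpoch_Suc)

text \<open>Convergence of an infinite product allows finitely many zero factors, so the limit
  vanishes only if some factor does.\<close>

lemma qpoch_inf_eq_0_iff: "qpoch_inf x q = 0 \<longleftrightarrow> (\<exists>n. x * q ^ n = 1)"
proof
  assume "qpoch_inf x q = 0"
  thus "\<exists>n. x * q ^ n = 1"
    using prodinf_nonzero[OF convergent_prod_qpoch[of x]] by (auto simp: qpoch_inf_def)
next
  assume "\<exists>n. x * q ^ n = 1"
  then obtain n where "x * q ^ n = 1" by blast
  thus "qpoch_inf x q = 0"
    using qpoch_inf_split[of x "Suc n"] by (simp add: qpoch_Suc)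
qed

lemma norm_mult_power_le: "norm (w * q ^ i) \<le> norm w"
proof -
  have "norm w * norm q ^ i \<le> norm w * 1"
    using q by (intro mult_left_mono power_le_one) auto
  thus ?thesis
    by (simp add: norm_mult norm_power)
qed

lemma qpoch_inf_small_nonzero:
  assumes "norm x < 1"
  shows "qpoch_inf x q \<noteq> 0"
  using assms norm_mult_power_le[of x] by (metis leD norm_one qpoch_inf_eq_0_iff)

lemma norm_qpoch_inf_diff_1_le: "norm (qpoch_inf x q - 1) \<le> exp (norm x / (1 - norm q)) - 1"
proof (rule LIMSEQ_le_const2)
  show "(\<lambda>n. norm (qpoch x q n - 1)) \<longlonglongrightarrow> norm (qpoch_inf x q - 1)"
    by (intro tendsto_intros qpoch_tendsto)
qed (use norm_qpoch_diff_1_le in auto)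

lemma norm_qpoch_inf_le: "norm (qpoch_inf x q) \<le> exp (norm x / (1 - norm q))"
  using norm_qpoch_inf_diff_1_le[of x] norm_triangle_sub[of "qpoch_inf x q" 1] by simp

text \<open>The partial products are polynomials in \<open>x\<close> and converge uniformly on
  closed unit discs by the M-test.\<close>

lemma holomorphic_qpoch_inf: "(\<lambda>x. qpoch_inf x q) holomorphic_on A"
proof -
  have "(\<lambda>x. qpoch_inf x q) holomorphic_on UNIV"
  proof (rule holomorphic_uniform_sequence)
    show "(\<lambda>x. qpoch x q n) holomorphic_on UNIV" for n
      unfolding qpoch_def by (intro holomorphic_intros)
    fix x :: complex
    have "uniformly_convergent_on (cball x 1) (\<lambda>N y. \<Prod>n<N. 1 - y * q ^ n)"
    proof (rule uniformly_convergent_on_prod')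
      show "uniformly_convergent_on (cball x 1) (\<lambda>N y. \<Sum>n<N. norm (1 - y * q ^ n - 1))"
      proof (rule Weierstrass_m_test'_ev)
        have "norm y \<le> norm x + 1" if "y \<in> cball x 1" for y
          using that norm_triangle_sub[of y x] by (simp add: dist_norm norm_minus_commute)
        thus "\<forall>\<^sub>F n in sequentially. \<forall>y\<in>cball x 1.
            norm (norm (1 - y * q ^ n - 1)) \<le> (norm x + 1) * norm q ^ n"
          by (intro always_eventually) (auto simp: norm_mult norm_power intro!: mult_right_mono)
        show "summable (\<lambda>n. (norm x + 1) * norm q ^ n)"
          using q by (intro summable_mult summable_geometric) auto
      qed
    qed (auto intro!: continuous_intros)
    then obtain l where l: "uniform_limit (cball x 1) (\<lambda>N y. qpoch y q N) l sequentially"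
      by (auto simp: qpoch_def uniformly_convergent_on_def)
    have "l y = qpoch_inf y q" if "y \<in> cball x 1" for y
      using tendsto_uniform_limitI[OF l that] qpoch_tendsto LIMSEQ_unique by blast
    hence "uniform_limit (cball x 1) (\<lambda>N y. qpoch y q N) (\<lambda>y. qpoch_inf y q) sequentially"
      using l by (subst (asm) uniform_limit_cong'[of _ _ _ l]) auto
    thus "\<exists>d>0. cball x d \<subseteq> UNIV \<and>
        uniform_limit (cball x d) (\<lambda>N y. qpoch y q N) (\<lambda>y. qpoch_inf y q) sequentially"
      by (intro exI[of _ 1]) auto
  qed auto
  thus ?thesis
    by (rule holomorphic_on_subset) auto
qed

lemma holomorphic_qpoch_inf':
  "f holomorphic_on A \<Longrightarrow> (\<lambda>x. qpoch_inf (f x) q) holomorphic_on A"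
  using holomorphic_on_compose[OF _ holomorphic_qpoch_inf, of f A] by (simp add: o_def)

lemma qpoch_inf_mult_minus: "qpoch_inf x q * qpoch_inf (- x) q = qpoch_inf (x\<^sup>2) (q\<^sup>2)"
  unfolding qpoch_inf_def
  by (subst prodinf_mult) (use convergent_prod_qpoch[of "- x"] in
      \<open>auto simp: convergent_prod_qpoch algebra_simps power2_eq_square power_mult_distrib\<close>)

lemma norm_qpoch_ratio_bounded:
  "\<exists>C>0. \<forall>n. norm (qpoch x q n / qpoch q q n) \<le> C"
proof -
  have "(\<lambda>n. qpoch x q n / qpoch q q n) \<longlonglongrightarrow> qpoch_inf x q / qpoch_inf q q"
    by (intro tendsto_intros qpoch_tendsto qpoch_inf_small_nonzero q)
  hence "Bseq (\<lambda>n. qpoch x q n / qpoch q q n)"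
    by (metis Bseq_conv_Bfun convergent_def convergent_imp_Bseq)
  thus ?thesis
    by (auto simp: Bseq_def)
qed

section \<open>The q-binomial theorem\<close>

lemma summable_q_binomial:
  assumes "norm x < 1"
  shows "summable (\<lambda>m. norm (qpoch A q m / qpoch q q m * x ^ m))"
proof -
  obtain C where C: "\<And>n. norm (qpoch A q n / qpoch q q n) \<le> C"
    using norm_qpoch_ratio_bounded by blast
  show ?thesis
  proof (rule summable_comparison_test')
    show "summable (\<lambda>m. C * norm x ^ m)"
      using assms by (intro summable_mult summable_geometric) auto
    show "norm (norm (qpoch A q m / qpoch q q m * x ^ m)) \<le> C * norm x ^ m" if "m \<ge> 0" for m
      unfolding norm_mult norm_power real_norm_def abs_mult using C[of m]
      by (intro mult_mono) (auto intro: order_trans[OF norm_ge_zero])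
  qed
qed

text \<open>The series \<open>f\<close> satisfies \<open>(1 - y) f(y) = (1 - A y) f(y q)\<close>.
  Iteration moves the argument to 0, where \<open>f\<close> is continuous with value 1, and leaves
  the quotient of products.\<close>

theorem q_binomial:
  assumes x: "norm x < 1"
  shows "(\<lambda>m. qpoch A q m / qpoch q q m * x ^ m) sums (qpoch_inf (A * x) q / qpoch_inf x q)"
proof -
  define c where "c = (\<lambda>m. qpoch A q m / qpoch q q m)"
  define f where "f = (\<lambda>x. \<Sum>m. c m * x ^ m)"
  have s: "summable (\<lambda>m. c m * y ^ m)" if "norm y < 1" for y
    using summable_norm_cancel[OF summable_q_binomial[OF that]] by (simp add: c_def)
  \<comment> \<open>This is \<open>c (Suc m) * (1 - q ^ Suc m) = c m * (1 - A * q ^ m)\<close>,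
    arranged for comparing coefficients in the functional equation.\<close>
  have c_Suc: "c (Suc m) - c m = c (Suc m) * q ^ Suc m - A * (c m * q ^ m)" for m
  proof -
    have "qpoch q q (Suc m) \<noteq> 0" "qpoch q q m \<noteq> 0"
      by (rule qpoch_base_nonzero)+
    thus ?thesis
      unfolding c_def by (simp add: field_simps qpoch_Suc)
  qed
  have rec: "(1 - y) * f y = (1 - A * y) * f (y * q)" if y: "norm y < 1" for y
  proof -
    have "norm y * norm q \<le> norm y * 1"
      using q by (intro mult_left_mono) auto
    hence yq: "norm (y * q) < 1"
      using y by (simp add: norm_mult)
    have f_sums: "(\<lambda>m. c m * z ^ m) sums f z" if "norm z < 1" for z
      unfolding f_def using s[OF that] by (rule summable_sums)
    have "(\<lambda>m. c m * y ^ m - c m * (y * q) ^ m) sums (f y - f (y * q))"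
      by (intro sums_diff f_sums y yq)
    hence "(\<lambda>m. c (Suc m) * y ^ Suc m - c (Suc m) * (y * q) ^ Suc m) sums (f y - f (y * q))"
      by (subst sums_Suc_iff) simp
    moreover have "c (Suc m) * y ^ Suc m - c (Suc m) * (y * q) ^ Suc m =
        y * (c m * y ^ m) - A * y * (c m * (y * q) ^ m)" for m
    proof -
      have "c (Suc m) * y ^ Suc m - c (Suc m) * (y * q) ^ Suc m =
          y ^ Suc m * (c (Suc m) - c (Suc m) * q ^ Suc m)"
        by (simp add: power_mult_distrib algebra_simps)
      also have "c (Suc m) - c (Suc m) * q ^ Suc m = c m - A * (c m * q ^ m)"
        using c_Suc[of m] by (simp add: algebra_simps)
      finally show ?thesis
        by (simp add: power_mult_distrib algebra_simps)
    qed
    ultimately have "(\<lambda>m. y * (c m * y ^ m) - A * y * (c m * (y * q) ^ m)) sums (f y - f (y * q))"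
      by simp
    moreover have "(\<lambda>m. y * (c m * y ^ m) - A * y * (c m * (y * q) ^ m)) sums
        (y * f y - A * y * f (y * q))"
      by (intro sums_diff sums_mult f_sums y yq)
    ultimately have "f y - f (y * q) = y * f y - A * y * f (y * q)"
      by (rule sums_unique2)
    thus ?thesis
      by (simp add: algebra_simps)
  qed
  have xq: "norm (x * q ^ n) < 1" for n
    using norm_mult_power_le[of x n] x by simp
  have iter: "qpoch x q n * f x = qpoch (A * x) q n * f (x * q ^ n)" for n
  proof (induction n)
    case (Suc n)
    have "qpoch x q (Suc n) * f x = (1 - x * q ^ n) * (qpoch x q n * f x)"
      by (simp add: qpoch_Suc)
    also have "\<dots> = qpoch (A * x) q n * ((1 - x * q ^ n) * f (x * q ^ n))"
      by (simp add: Suc.IH)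
    also have "\<dots> = qpoch (A * x) q (Suc n) * f (x * q ^ Suc n)"
      by (subst rec[OF xq]) (simp add: qpoch_Suc mult_ac)
    finally show ?case .
  qed simp
  have "isCont f 0"
    unfolding f_def by (rule isCont_powser[of _ "1/2"]) (auto intro!: s simp: norm_divide)
  moreover have "(\<lambda>n. x * q ^ n) \<longlonglongrightarrow> x * 0"
    using q by (intro tendsto_intros LIMSEQ_power_zero)
  ultimately have "(\<lambda>n. f (x * q ^ n)) \<longlonglongrightarrow> f 0"
    using isCont_tendsto_compose by fastforce
  moreover have "f 0 = 1"
    unfolding f_def powser_zero by (simp add: c_def)
  ultimately have "(\<lambda>n. qpoch (A * x) q n * f (x * q ^ n)) \<longlonglongrightarrow> qpoch_inf (A * x) q * 1"
    by (intro tendsto_intros qpoch_tendsto) auto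
  moreover have "(\<lambda>n. qpoch x q n * f x) \<longlonglongrightarrow> qpoch_inf x q * f x"
    by (intro tendsto_intros qpoch_tendsto)
  ultimately have "qpoch_inf x q * f x = qpoch_inf (A * x) q"
    using LIMSEQ_unique by (auto simp: iter)
  hence "f x = qpoch_inf (A * x) q / qpoch_inf x q"
    using qpoch_inf_small_nonzero[OF x] by (simp add: field_simps)
  thus ?thesis
    using summable_sums[OF s[OF x]] by (simp add: f_def c_def)
qed

end

section \<open>The theta quotient as a difference of bilateral series\<close>

text \<open>The modified Jacobi theta function; for \<open>0 < norm q < 1\<close> its zeros
  \<open>x \<noteq> 0\<close> are the integral powers of \<open>q\<close>.\<close>

definition qtheta :: "complex \<Rightarrow> complex \<Rightarrow> complex" where
  "qtheta x q = qpoch_inf x q * qpoch_inf (q / x) q"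

text \<open>Since \<open>x / (1 - x^2)\<close> is the odd part of \<open>x / (1 - x)\<close>, this
  is the odd part in \<open>c\<close> of the Lambert series \<open>L(c q)\<close>.\<close>

definition odd_lambert :: "complex \<Rightarrow> complex \<Rightarrow> complex" where
  "odd_lambert c q = (\<Sum>j. c * q ^ Suc j / (1 - c\<^sup>2 * q ^ (2 * Suc j)))"

text \<open>The bilateral series with terms \<open>a q\<^sup>j / (1 - a\<^sup>2 q\<^sup>2\<^sup>j)\<close>, folded at \<open>j = 0\<close>.\<close>
definition bilateral_lambert :: "complex \<Rightarrow> complex \<Rightarrow> complex" where
  "bilateral_lambert a q = a / (1 - a\<^sup>2) + odd_lambert a q - odd_lambert (1 / a) q"

text \<open>The products of the theorem grouped into theta functions: \<open>q a / b\<close> pairs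
  with \<open>b / a\<close>, and \<open>- q / (a b)\<close> with \<open>- a b\<close>.\<close>

definition theta_quotient :: "complex \<Rightarrow> complex \<Rightarrow> complex \<Rightarrow> complex" where
  "theta_quotient a b q = a * qtheta (b / a) q * qtheta (- (a * b)) q * (qpoch_inf (q\<^sup>2) (q\<^sup>2))\<^sup>2 /
     (qtheta (a\<^sup>2) (q\<^sup>2) * qtheta (b\<^sup>2) (q\<^sup>2))"

lemma holomorphic_factor:
  assumes "g holomorphic_on S" "open S" "g a = 0"
  obtains h where "h holomorphic_on S" "\<And>z. z \<in> S \<Longrightarrow> g z = (z - a) * h z"
proof
  let ?h = "\<lambda>z. if z = a then deriv g a else g z / (z - a)"
  show "?h holomorphic_on S"
    by (rule pole_theorem_open_0[OF assms(1,2)]) (use assms(3) in auto)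
  show "g z = (z - a) * ?h z" if "z \<in> S" for z
    using assms(3) by auto
qed

text \<open>Every orbit under multiplication by \<open>q\<close> meets a fundamental
  annulus.\<close>

lemma ex_powi_normalize:
  fixes q x :: complex
  assumes "0 < norm q" "norm q < 1" "x \<noteq> 0"
  obtains m :: int where "norm q < norm (x * q powi m)" "norm (x * q powi m) \<le> 1"
proof
  \<comment> \<open>\<open>t\<close> is the logarithm of \<open>norm x\<close> to base
    \<open>norm q\<close>; the shift by \<open>- \<lfloor>t\<rfloor>\<close> leaves the fractional
    part of \<open>t\<close> as exponent.\<close>
  define t where "t = ln (norm x) / ln (norm q)"
  have lnq: "ln (norm q) < 0"
    using assms by simp
  have x: "norm x = norm q powr t"
    using assms lnq by (simp add: powr_def t_def)
  have "norm (x * q powi (- \<lfloor>t\<rfloor>)) = norm q powr t * norm q powr (of_int (- \<lfloor>t\<rfloor>))"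
    using assms powr_real_of_int'[of "norm q" "- \<lfloor>t\<rfloor>"] by (simp add: norm_mult norm_power_int x)
  also have "\<dots> = norm q powr (t - \<lfloor>t\<rfloor>)"
    by (simp add: powr_add[symmetric])
  finally have eq: "norm (x * q powi (- \<lfloor>t\<rfloor>)) = norm q powr (t - \<lfloor>t\<rfloor>)" .
  have "norm q powr 1 < norm q powr (t - \<lfloor>t\<rfloor>)"
    using assms by (intro powr_less_mono') (auto, linarith)
  thus "norm q < norm (x * q powi (- \<lfloor>t\<rfloor>))"
    using assms by (simp add: eq)
  have "norm q powr (t - \<lfloor>t\<rfloor>) \<le> norm q powr 0"
    using assms by (intro powr_mono') auto
  thus "norm (x * q powi (- \<lfloor>t\<rfloor>)) \<le> 1"
    using assms by (simp add: eq)
qed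

section \<open>Quasi-periodicity of theta functions\<close>

lemma qtheta_shift:
  assumes "norm q < 1" "q \<noteq> 0" "x \<noteq> 0"
  shows "qtheta (x * q) q = - qtheta x q / x"
proof -
  have "qtheta (x * q) q = qpoch_inf (x * q) q * qpoch_inf (1 / x) q"
    using assms by (simp add: qtheta_def)
  thus ?thesis
    unfolding qtheta_def qpoch_inf_rec[OF assms(1), of x] qpoch_inf_rec[OF assms(1), of "1 / x"]
    using assms by (simp add: field_simps)
qed

context
  fixes q :: complex
  assumes q0: "0 < norm q" and q: "norm q < 1"
begin

text \<open>Applied to \<open>b\<close>, this evaluates the numerator of the theta quotient at
  \<open>a = 1\<close> and \<open>a = -1\<close>, and hence its residues there.\<close>

lemma qtheta_mult_minus: "qtheta x q * qtheta (- x) q = qtheta (x\<^sup>2) (q\<^sup>2)"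
  using qpoch_inf_mult_minus[OF q, of x] qpoch_inf_mult_minus[OF q, of "q / x"]
  by (simp add: qtheta_def power_divide mult_ac)

lemma norm_q2: "norm (q\<^sup>2) < 1"
  using q q0 by (simp add: norm_power power_less_one_iff)

lemma qtheta_sq_nonzero:
  assumes "x \<noteq> 0" "\<And>m::int. x\<^sup>2 * q powi m \<noteq> 1"
  shows "qtheta (x\<^sup>2) (q\<^sup>2) \<noteq> 0"
proof -
  have q0': "q \<noteq> 0" using q0 by auto
  have "x\<^sup>2 * (q\<^sup>2) ^ n \<noteq> 1" for n
    using assms(2)[of "int (2 * n)"] by (simp only: power_int_of_nat power_mult) auto
  moreover have "q\<^sup>2 / x\<^sup>2 * (q\<^sup>2) ^ n \<noteq> 1" for n
  proof
    assume "q\<^sup>2 / x\<^sup>2 * (q\<^sup>2) ^ n = 1"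
    hence "q ^ (2 * Suc n) = x\<^sup>2"
      using assms(1) by (simp add: field_simps power_mult power_add power2_eq_square)
    hence "x\<^sup>2 * q powi (- int (2 * Suc n)) = 1"
      using q0' by (simp only: power_int_minus power_int_of_nat) (auto simp: field_simps)
    thus False
      using assms(2) by blast
  qed
  ultimately show ?thesis
    unfolding qtheta_def using norm_q2 by (auto simp: qpoch_inf_eq_0_iff)
qed

text \<open>The multipliers cancel: \<open>q\<close> from the prefactor, \<open>- b / (a q)\<close>
  and \<open>1 / (a b)\<close> from the numerator, against \<open>- 1 / a^2\<close> from the
  denominator.\<close>

lemma theta_quotient_shift:
  assumes "a \<noteq> 0" "b \<noteq> 0"
  shows "theta_quotient (a * q) b q = theta_quotient a b q"
proof -
  have q0': "q \<noteq> 0" using q0 by auto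
  have 1: "qtheta (b / (a * q)) q = - b / (a * q) * qtheta (b / a) q"
    using qtheta_shift[OF q, of "b / (a * q)"] assms q0' by (simp add: field_simps)
  have 2: "qtheta (- (a * q * b)) q = qtheta (- (a * b)) q / (a * b)"
    using qtheta_shift[OF q, of "- (a * b)"] assms q0' by (simp add: mult_ac)
  have 3: "qtheta ((a * q)\<^sup>2) (q\<^sup>2) = - qtheta (a\<^sup>2) (q\<^sup>2) / a\<^sup>2"
    using qtheta_shift[OF norm_q2, of "a\<^sup>2"] assms q0' by (simp add: power_mult_distrib)
  show ?thesis
    unfolding theta_quotient_def 1 2 3 using assms q0' 
    by (simp add: field_simps power2_eq_square)
qed

section \<open>The odd Lambert series and its bilateral form\<close>

lemma summable_odd_lambert: "summable (\<lambda>j. c * q ^ Suc j / (1 - c\<^sup>2 * q ^ (2 * Suc j)))"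
proof (rule summable_comparison_test_ev)
  \<comment> \<open>No condition on \<open>c\<close> enters: a zero denominator only makes a term 0,
    and eventually all denominators have norm at least 1/2.\<close>
  have "(\<lambda>j. c\<^sup>2 * (q\<^sup>2) ^ Suc j) \<longlonglongrightarrow> c\<^sup>2 * 0"
    using norm_q2 by (intro tendsto_intros filterlim_compose[OF _ filterlim_Suc] LIMSEQ_power_zero)
  hence "(\<lambda>j. norm (c\<^sup>2 * q ^ (2 * Suc j))) \<longlonglongrightarrow> 0"
    unfolding power_mult by (simp add: tendsto_norm_zero_iff)
  hence "eventually (\<lambda>j. norm (c\<^sup>2 * q ^ (2 * Suc j)) < 1 / 2) sequentially"
    by (rule order_tendstoD) auto
  thus "eventually (\<lambda>j. norm (c * q ^ Suc j / (1 - c\<^sup>2 * q ^ (2 * Suc j))) \<le>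
      2 * norm c * norm q ^ Suc j) sequentially"
  proof eventually_elim
    case (elim j)
    have "norm (1 - c\<^sup>2 * q ^ (2 * Suc j)) \<ge> 1 / 2"
      using norm_triangle_ineq2[of 1 "c\<^sup>2 * q ^ (2 * Suc j)"] elim by simp
    hence "norm (c * q ^ Suc j) / norm (1 - c\<^sup>2 * q ^ (2 * Suc j)) \<le> norm (c * q ^ Suc j) / (1 / 2)"
      by (intro divide_left_mono) auto
    thus ?case
      by (simp only: norm_divide) (simp add: norm_mult norm_power)
  qed
  show "summable (\<lambda>j. 2 * norm c * norm q ^ Suc j)"
    using q by (intro summable_mult summable_ignore_initial_segment[of _ 1, simplified] summable_geometric) auto
qed

lemma odd_lambert_rec: "odd_lambert c q = c * q / (1 - c\<^sup>2 * q\<^sup>2) + odd_lambert (c * q) q"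
  unfolding odd_lambert_def
  using suminf_split_head[OF summable_odd_lambert[of c]]
  by (simp add: power_mult_distrib power2_eq_square mult_ac)

text \<open>The shift moves the centre of the bilateral series by one term. The old central term
  reappears in the other half, because \<open>x / (1 - x^2)\<close> changes sign under
  inversion.\<close>

lemma bilateral_lambert_shift:
  assumes "a \<noteq> 0"
  shows "bilateral_lambert (a * q) q = bilateral_lambert a q"
proof -
  have q0': "q \<noteq> 0" using q0 by auto
  have 1: "odd_lambert a q = a * q / (1 - (a * q)\<^sup>2) + odd_lambert (a * q) q"
    using odd_lambert_rec[of a] by (simp add: power_mult_distrib)
  have "odd_lambert (1 / (a * q)) q = (1 / a) / (1 - (1 / a)\<^sup>2) + odd_lambert (1 / a) q"
    using odd_lambert_rec[of "1 / (a * q)"] q0' by (simp add: power_mult_distrib power_divide)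
  also have "(1 / a) / (1 - (1 / a)\<^sup>2) = - (a / (1 - a\<^sup>2))"
    \<comment> \<open>For \<open>a^2 = 1\<close> both sides are 0 by the convention for division by
      zero.\<close>
    using assms by (cases "a\<^sup>2 = 1") (auto simp: field_simps power2_eq_square)
  finally show ?thesis
    unfolding bilateral_lambert_def 1 by simp
qed

text \<open>The poles closest to 0 come from \<open>j = 0\<close>, at \<open>c^2 q^2 = 1\<close>,
  whence the radius. For \<open>norm c \<le> r\<close> all denominators are bounded below by
  \<open>1 - (r * norm q)^2\<close>.\<close>

lemma holomorphic_odd_lambert: "(\<lambda>c. odd_lambert c q) holomorphic_on ball 0 (1 / norm q)"
proof (rule holomorphic_uniform_sequence)
  have nz: "1 - c\<^sup>2 * q ^ (2 * Suc j) \<noteq> 0 \<and>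
      norm (c * q ^ Suc j / (1 - c\<^sup>2 * q ^ (2 * Suc j))) \<le> r * norm q ^ Suc j / (1 - (r * norm q)\<^sup>2)"
    if c: "norm c \<le> r" and r: "r < 1 / norm q" for c r j
  proof -
    have r0: "0 \<le> r" "r * norm q < 1"
      using c r q0 norm_ge_zero[of c] by (linarith, simp add: field_simps)
    have "norm (c\<^sup>2 * q ^ (2 * Suc j)) = (norm c * norm q ^ Suc j)\<^sup>2"
      by (simp add: norm_mult norm_power power_mult_distrib power_mult power2_eq_square mult_ac)
    also have "norm c * norm q ^ Suc j \<le> r * norm q ^ 1"
      using q c r0 by (intro mult_mono power_decreasing) auto
    hence "(norm c * norm q ^ Suc j)\<^sup>2 \<le> (r * norm q)\<^sup>2"
      by (intro power_mono) auto
    finally have le: "norm (c\<^sup>2 * q ^ (2 * Suc j)) \<le> (r * norm q)\<^sup>2" .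
    have lt: "(r * norm q)\<^sup>2 < 1"
      using r0 by (intro power_less_one_iff[THEN iffD2]) (auto simp: power_less_one_iff)
    have ge: "1 - (r * norm q)\<^sup>2 \<le> norm (1 - c\<^sup>2 * q ^ (2 * Suc j))"
      using norm_triangle_ineq2[of 1 "c\<^sup>2 * q ^ (2 * Suc j)"] le by simp
    have "norm (c * q ^ Suc j) / norm (1 - c\<^sup>2 * q ^ (2 * Suc j)) \<le>
        (r * norm q ^ Suc j) / (1 - (r * norm q)\<^sup>2)"
      unfolding norm_mult norm_power using lt ge c r0
      by (intro frac_le mult_right_mono mult_nonneg_nonneg) (auto simp: norm_mult norm_power)
    moreover have "1 - c\<^sup>2 * q ^ (2 * Suc j) \<noteq> 0"
      using lt ge by auto
    ultimately show ?thesis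
      by (simp only: norm_divide) auto
  qed
  show "(\<lambda>c. \<Sum>j<N. c * q ^ Suc j / (1 - c\<^sup>2 * q ^ (2 * Suc j))) holomorphic_on ball 0 (1 / norm q)" for N
    using nz by (intro holomorphic_intros) (auto simp del: power_Suc)
  fix x :: complex
  assume x: "x \<in> ball 0 (1 / norm q)"
  define d where "d = (1 / norm q - norm x) / 2"
  have d: "d > 0" "norm x + d < 1 / norm q"
    using x by (auto simp: d_def field_simps)
  have le: "norm y \<le> norm x + d" if "y \<in> cball x d" for y
    using that norm_triangle_sub[of y x] by (simp add: dist_norm norm_minus_commute)
  have "cball x d \<subseteq> ball 0 (1 / norm q)"
    using le d by force
  moreover have "uniform_limit (cball x d) (\<lambda>N c. \<Sum>j<N. c * q ^ Suc j / (1 - c\<^sup>2 * q ^ (2 * Suc j)))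
      (\<lambda>c. odd_lambert c q) sequentially"
    unfolding odd_lambert_def
  proof (rule Weierstrass_m_test)
    show "norm (c * q ^ Suc j / (1 - c\<^sup>2 * q ^ (2 * Suc j))) \<le>
        (norm x + d) * norm q ^ Suc j / (1 - ((norm x + d) * norm q)\<^sup>2)" if "c \<in> cball x d" for j c
      using nz[OF le[OF that] d(2)] by blast
    show "summable (\<lambda>j. (norm x + d) * norm q ^ Suc j / (1 - ((norm x + d) * norm q)\<^sup>2))"
      using q by (intro summable_divide summable_mult summable_ignore_initial_segment[of _ 1, simplified]
          summable_geometric) auto
  qed
  ultimately show "\<exists>d>0. cball x d \<subseteq> ball 0 (1 / norm q) \<and>
      uniform_limit (cball x d) (\<lambda>N c. \<Sum>j<N. c * q ^ Suc j / (1 - c\<^sup>2 * q ^ (2 * Suc j)))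
      (\<lambda>c. odd_lambert c q) sequentially"
    using d(1) by blast
qed auto


section \<open>Comparison of periodic functions on an annulus\<close>

lemma shift_invariant_powi:
  assumes "\<And>a. a \<noteq> 0 \<Longrightarrow> F (a * q) = F a" "a \<noteq> 0"
  shows "F (a * q powi m) = F a"
proof -
  have q0': "q \<noteq> 0" using q0 by auto
  have pos: "F (a * q ^ n) = F a" if "a \<noteq> 0" for n a
    using that
  proof (induction n)
    case (Suc n)
    thus ?case
      using assms(1)[of "a * q ^ n"] q0' by (simp add: mult_ac)
  qed simp
  show ?thesis
  proof (cases "m \<ge> 0")
    case True
    thus ?thesis
      using pos[OF assms(2), of "nat m"] by (simp add: power_int_def)
  next
    case False
    have "F (a / q ^ nat (- m) * q ^ nat (- m)) = F (a / q ^ nat (- m))"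
      by (rule pos) (use assms(2) q0' in auto)
    thus ?thesis
      using False q0' by (simp add: power_int_def field_simps)
  qed
qed

theorem bilateral_lambert_diff:
  assumes a: "a \<noteq> 0" "\<And>m::int. a\<^sup>2 * q powi m \<noteq> 1"
      and b: "b \<noteq> 0" "\<And>m::int. b\<^sup>2 * q powi m \<noteq> 1"
  shows "bilateral_lambert a q - bilateral_lambert b q = theta_quotient a b q"
proof -
  have q0': "q \<noteq> 0" using q0 by auto
  \<comment> \<open>\<open>D\<close> is to be shown to vanish. \<open>M\<close> is the denominator
    of the theta quotient without its factor \<open>1 - x^2\<close>, and \<open>g\<close> is
    \<open>(1 - x^2) * D x\<close> with the poles at 1 and -1 cancelled, hence holomorphic on
    \<open>S\<close>.\<close>
  define D where "D = (\<lambda>x. bilateral_lambert x q - bilateral_lambert b q - theta_quotient x b q)"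
  define S where "S = {x::complex. norm q < norm (x - 0) \<and> norm (x - 0) < 1 / norm q}"
  define N where "N = (\<lambda>x. qtheta (b / x) q * qtheta (- (x * b)) q * (qpoch_inf (q\<^sup>2) (q\<^sup>2))\<^sup>2)"
  define M where "M = (\<lambda>x. qpoch_inf (x\<^sup>2 * q\<^sup>2) (q\<^sup>2) * qpoch_inf (q\<^sup>2 / x\<^sup>2) (q\<^sup>2) * qtheta (b\<^sup>2) (q\<^sup>2))"
  define g where "g = (\<lambda>x. x + (1 - x\<^sup>2) * (odd_lambert x q - odd_lambert (1 / x) q - bilateral_lambert b q)
    - x * (N x / M x))"
  have S_iff: "x \<in> S \<longleftrightarrow> norm q < norm x \<and> norm x < 1 / norm q" for x
    by (simp add: S_def)
  have openS: "open S"
    unfolding S_def by (intro open_Collect_conj open_Collect_less continuous_intros)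
  have S_nz: "x \<noteq> 0" if "x \<in> S" for x
    using that q0 by (auto simp: S_iff)
  have norm_q1: "1 < 1 / norm q"
    using q q0 by simp
  have oneS: "1 \<in> S" "-1 \<in> S"
    using q norm_q1 by (auto simp: S_iff)
  have theta_b: "qtheta (b\<^sup>2) (q\<^sup>2) \<noteq> 0"
    using b by (rule qtheta_sq_nonzero)
  have M_nz: "M x \<noteq> 0" if x: "x \<in> S" for x
  proof -
    have "norm (x * q) < 1" "norm (q / x) < 1"
      using x q0 S_nz[OF x] by (auto simp: S_iff norm_mult norm_divide field_simps)
    hence "norm ((x * q)\<^sup>2) < 1" "norm ((q / x)\<^sup>2) < 1"
      unfolding norm_power by (auto simp: power_less_one_iff)
    hence "norm (x\<^sup>2 * q\<^sup>2) < 1" "norm (q\<^sup>2 / x\<^sup>2) < 1"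
      by (simp_all add: power_mult_distrib power_divide)
    thus ?thesis
      unfolding M_def using theta_b qpoch_inf_small_nonzero[OF norm_q2] by simp
  qed
  have holg: "g holomorphic_on S"
  proof -
    have "(\<lambda>x. odd_lambert (1 / x) q) holomorphic_on S"
    proof -
      have "norm (1 / x) < 1 / norm q" if "x \<in> S" for x
        using that q0 S_nz[OF that] by (auto simp: S_iff norm_divide field_simps)
      hence "(\<lambda>c. odd_lambert c q) \<circ> (\<lambda>x. 1 / x) holomorphic_on S"
        by (intro holomorphic_on_compose_gen[OF _ holomorphic_odd_lambert] holomorphic_intros)
           (auto dest: S_nz)
      thus ?thesis by (simp add: o_def)
    qed
    moreover have "(\<lambda>x. odd_lambert x q) holomorphic_on S"
      by (rule holomorphic_on_subset[OF holomorphic_odd_lambert]) (auto simp: S_iff)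
    moreover have "N holomorphic_on S"
      unfolding N_def qtheta_def using b(1) q0'
      by (intro holomorphic_intros holomorphic_qpoch_inf'[OF q]) (auto dest: S_nz)
    moreover have "M holomorphic_on S"
      unfolding M_def by (intro holomorphic_intros holomorphic_qpoch_inf'[OF norm_q2]) (auto dest: S_nz)
    ultimately show ?thesis
      unfolding g_def by (intro holomorphic_intros M_nz)
  qed
  have g_eq: "g x = (1 - x\<^sup>2) * D x" if "x \<in> S" "x\<^sup>2 \<noteq> 1" for x
  proof -
    have "qtheta (x\<^sup>2) (q\<^sup>2) * qtheta (b\<^sup>2) (q\<^sup>2) = (1 - x\<^sup>2) * M x"
      using qpoch_inf_rec[OF norm_q2, of "x\<^sup>2"] by (simp add: qtheta_def M_def)
    hence "theta_quotient x b q = x * N x / ((1 - x\<^sup>2) * M x)"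
      by (simp add: theta_quotient_def N_def)
    hence "(1 - x\<^sup>2) * theta_quotient x b q = x * (N x / M x)"
      using that by simp
    moreover have "(1 - x\<^sup>2) * (x / (1 - x\<^sup>2)) = x"
      using that by simp
    hence "(1 - x\<^sup>2) * bilateral_lambert x q = x + (1 - x\<^sup>2) * (odd_lambert x q - odd_lambert (1 / x) q)"
      unfolding bilateral_lambert_def by (simp only: ring_distribs) simp
    ultimately show ?thesis
      unfolding g_def D_def by (simp only: ring_distribs) (simp add: algebra_simps)
  qed
  \<comment> \<open>At these points \<open>N\<close> contains
    \<open>qtheta b q * qtheta (- b) q\<close>, so the residues of both sides agree and
    \<open>g\<close> vanishes there.\<close>
  have NM: "N x / M x = 1" if "x = 1 \<or> x = -1" for x
  proof -
    have "N x = qtheta (b\<^sup>2) (q\<^sup>2) * (qpoch_inf (q\<^sup>2) (q\<^sup>2))\<^sup>2"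
      using that qtheta_mult_minus[of b] by (auto simp: N_def mult.commute)
    moreover have "M x = qtheta (b\<^sup>2) (q\<^sup>2) * (qpoch_inf (q\<^sup>2) (q\<^sup>2))\<^sup>2"
      using that by (auto simp: M_def power2_eq_square)
    moreover have "M x \<noteq> 0"
      using that oneS M_nz by auto
    ultimately show ?thesis by simp
  qed
  have "g 1 = 0" "g (-1) = 0"
    by (simp_all add: g_def NM)
  obtain h1 where h1: "h1 holomorphic_on S" "\<And>z. z \<in> S \<Longrightarrow> g z = (z - 1) * h1 z"
    using holomorphic_factor[OF holg openS \<open>g 1 = 0\<close>] by blast
  have "h1 (-1) = 0"
    using h1(2)[OF oneS(2)] \<open>g (-1) = 0\<close> by simp
  obtain h where h: "h holomorphic_on S" "\<And>z. z \<in> S \<Longrightarrow> h1 z = (z - (-1)) * h z"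
    using holomorphic_factor[OF h1(1) openS \<open>h1 (-1) = 0\<close>] by blast
  \<comment> \<open>\<open>h\<close> is \<open>- D\<close> with the singularities at 1 and -1
    removed; the sign comes from \<open>(x - 1) * (x + 1) = - (1 - x^2)\<close>.\<close>
  have h_eq: "h x = - D x" if "x \<in> S" "x\<^sup>2 \<noteq> 1" for x
  proof -
    have "(1 - x\<^sup>2) * D x = (1 - x\<^sup>2) * (- h x)"
      using g_eq[OF that] h1(2)[OF that(1)] h(2)[OF that(1)]
      by (simp add: algebra_simps power2_eq_square)
    hence "D x = - h x"
      using that by (subst (asm) mult_left_cancel) auto
    thus ?thesis by simp
  qed
  have D_shift: "D (x * q) = D x" if "x \<noteq> 0" for x
    using that b(1) by (simp add: D_def bilateral_lambert_shift theta_quotient_shift)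
  \<comment> \<open>If both points lie in \<open>S\<close>, then
    \<open>norm x > 1 > norm (x * q)\<close>, so neither is 1 or -1.\<close>
  have h_shift: "h (x * q) = h x" if "x \<in> S" "x * q \<in> S" for x
  proof -
    have "norm x > 1" "norm (x * q) < 1"
      using that q0 by (auto simp: S_iff norm_mult field_simps)
    hence "x\<^sup>2 \<noteq> 1" "(x * q)\<^sup>2 \<noteq> 1"
      by (auto simp: power2_eq_1_iff)
    thus ?thesis
      using that h_eq D_shift S_nz by simp
  qed
  \<comment> \<open>The outer radius of \<open>K\<close> is the inner one divided by
    \<open>norm q\<close>, so a single shift carries each point of \<open>S\<close> outside
    \<open>K\<close> into \<open>K\<close>. The maximum of \<open>norm (h x)\<close> over the
    compact \<open>K\<close> is then attained inside the open annulus \<open>S\<close>.\<close>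
  define K where "K = {x::complex. sqrt (norm q) \<le> norm x \<and> norm x \<le> 1 / sqrt (norm q)}"
  have sq: "norm q < sqrt (norm q)" "sqrt (norm q) < 1" "sqrt (norm q) > 0"
    using q q0 by (auto intro: real_less_rsqrt simp: power2_eq_square)
  have KS: "K \<subseteq> S"
  proof -
    have "1 / sqrt (norm q) < 1 / norm q"
      using sq q0 by (intro divide_strict_left_mono) auto
    thus ?thesis
      using sq by (auto simp: K_def S_iff)
  qed
  have "compact K"
  proof -
    have "closed K"
      unfolding K_def by (intro closed_Collect_conj closed_Collect_le continuous_intros)
    moreover have "bounded K"
      unfolding bounded_iff K_def by blast
    ultimately show ?thesis
      by (simp add: compact_eq_bounded_closed)
  qed
  moreover have "1 \<in> K"
    using sq by (auto simp: K_def)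
  moreover have "continuous_on K (\<lambda>x. norm (h x))"
    using holomorphic_on_imp_continuous_on[OF h(1)] KS
    by (intro continuous_intros) (rule continuous_on_subset)
  ultimately obtain \<xi> where \<xi>: "\<xi> \<in> K" "\<And>x. x \<in> K \<Longrightarrow> norm (h x) \<le> norm (h \<xi>)"
    using continuous_attains_sup[of K "\<lambda>x. norm (h x)"] by blast
  have sqq: "sqrt (norm q) * sqrt (norm q) = norm q"
    by simp
  have max: "norm (h x) \<le> norm (h \<xi>)" if x: "x \<in> S" for x
  proof -
    consider "x \<in> K" | "norm x < sqrt (norm q)" | "norm x > 1 / sqrt (norm q)"
      unfolding K_def by force
    thus ?thesis
    proof cases
      case 1
      thus ?thesis by (rule \<xi>(2))
    next
      case 2
      have "norm (x / q) > 1" "norm (x / q) < 1 / sqrt (norm q)"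
      proof -
        show "norm (x / q) > 1"
          using x q0 by (simp add: S_iff norm_divide)
        have "norm x / norm q < sqrt (norm q) / norm q"
          using 2 q0 by (intro divide_strict_right_mono)
        also have "sqrt (norm q) / norm q = 1 / sqrt (norm q)"
          using q0 sqq by (simp add: field_simps)
        finally show "norm (x / q) < 1 / sqrt (norm q)"
          by (simp add: norm_divide)
      qed
      hence "x / q \<in> K"
        unfolding K_def mem_Collect_eq using sq(2) by linarith
      thus ?thesis
        using h_shift[of "x / q"] KS x q0' \<xi>(2)[of "x / q"] by auto
    next
      case 3
      have "norm (x * q) < 1" "norm (x * q) > sqrt (norm q)"
      proof -
        show "norm (x * q) < 1"
          using x q0 by (simp add: S_iff norm_mult field_simps)
        have "1 / sqrt (norm q) * norm q < norm x * norm q"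
          using 3 q0 by (intro mult_strict_right_mono)
        also have "1 / sqrt (norm q) * norm q = sqrt (norm q)"
          using q0 sqq by (simp add: field_simps)
        finally show "norm (x * q) > sqrt (norm q)"
          by (simp add: norm_mult)
      qed
      moreover have "1 < 1 / sqrt (norm q)"
        using sq by simp
      ultimately have "x * q \<in> K"
        unfolding K_def mem_Collect_eq by linarith
      thus ?thesis
        using h_shift[of x] KS x \<xi>(2)[of "x * q"] by auto
    qed
  qed
  have "h constant_on S"
  proof (rule maximum_modulus_principle[OF h(1) openS _ openS])
    show "connected S"
      unfolding S_def by (rule connected_annulus) simp
    show "\<xi> \<in> S"
      using \<xi>(1) KS by blast
  qed (use max in auto)
  then obtain C where C: "\<And>x. x \<in> S \<Longrightarrow> h x = C"
    unfolding constant_on_def by blast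
  \<comment> \<open>By periodicity \<open>D\<close> can be evaluated at a representative in
    \<open>S\<close>; the hypothesis on \<open>x\<close> keeps that representative away from 1 and
    -1.\<close>
  have D_const: "D x = - C" if x: "x \<noteq> 0" "\<And>m::int. x\<^sup>2 * q powi m \<noteq> 1" for x
  proof -
    obtain m :: int where m: "norm q < norm (x * q powi m)" "norm (x * q powi m) \<le> 1"
      using ex_powi_normalize[OF q0 q x(1)] by blast
    have "x * q powi m \<in> S"
      using m norm_q1 by (auto simp: S_iff)
    moreover have "(x * q powi m)\<^sup>2 = x\<^sup>2 * q powi (2 * m)"
      by (simp add: power_mult_distrib power_int_power' mult.commute)
    hence "(x * q powi m)\<^sup>2 \<noteq> 1"
      using x(2) by simp
    ultimately have "D (x * q powi m) = - C"
      using C h_eq by fastforce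
    moreover have "D (x * q powi m) = D x"
      by (rule shift_invariant_powi) (use D_shift x in auto)
    ultimately show ?thesis by simp
  qed
  \<comment> \<open>The factor \<open>qtheta (b / b) q\<close> vanishes, which determines the
    constant.\<close>
  have "D b = 0"
  proof -
    have "qpoch_inf 1 q = 0"
      using qpoch_inf_rec[OF q, of 1] by simp
    thus ?thesis
      using b(1) by (simp add: D_def theta_quotient_def qtheta_def)
  qed
  hence "D a = 0"
    using D_const[OF a] D_const[OF b] by simp
  thus ?thesis
    by (simp add: D_def)
qed

end

section \<open>Exchange of summations\<close>

text \<open>Tannery's theorem for Cauchy products. Absolute summability is asked of \<open>f\<close>
  alone, so \<open>X\<close> may consist of the partial sums of a conditionally convergent
  series.\<close>

lemma convolution_tendsto:
  fixes f X :: "nat \<Rightarrow> 'a :: {real_normed_algebra, banach}"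
  assumes f: "summable (\<lambda>n. norm (f n))" and X: "X \<longlonglongrightarrow> L"
  shows "(\<lambda>N. \<Sum>m\<le>N. f m * X (N - m)) \<longlonglongrightarrow> (\<Sum>m. f m) * L"
proof -
  obtain B where B: "\<And>n. norm (X n) \<le> B"
    using X by (meson BseqE convergent_def convergent_imp_Bseq)
  have "(\<lambda>N. \<Sum>m. if m \<le> N then f m * X (N - m) else 0) \<longlonglongrightarrow> (\<Sum>m. f m * L)"
  proof (intro tannerys_theorem[THEN conjunct2, THEN conjunct2])
    show "(\<lambda>N. if m \<le> N then f m * X (N - m) else 0) \<longlonglongrightarrow> f m * L" for m
    proof (rule Lim_transform_eventually)
      have "(\<lambda>N. X (N - m)) \<longlonglongrightarrow> L"
        using LIMSEQ_offset[of "\<lambda>N. X (N - m)" m] X by simp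
      thus "(\<lambda>N. f m * X (N - m)) \<longlonglongrightarrow> f m * L"
        by (intro tendsto_intros)
      show "eventually (\<lambda>N. f m * X (N - m) = (if m \<le> N then f m * X (N - m) else 0)) sequentially"
        using eventually_ge_at_top[of m] by eventually_elim auto
    qed
    have "B \<ge> 0"
      using B[of 0] norm_ge_zero order_trans by blast
    have "norm (f m * X k) \<le> norm (f m) * B" for m k
      by (rule order_trans[OF norm_mult_ineq]) (intro mult_left_mono B norm_ge_zero)
    with \<open>B \<ge> 0\<close> show "eventually (\<lambda>(m, N). norm (if m \<le> N then f m * X (N - m) else 0) \<le> norm (f m) * B)
        (sequentially \<times>\<^sub>F sequentially)"
      by (intro always_eventually) auto
    show "summable (\<lambda>m. norm (f m) * B)"
      by (intro summable_mult2 f)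
  qed auto
  moreover have "(\<Sum>m. if m \<le> N then f m * X (N - m) else 0) = (\<Sum>m\<le>N. f m * X (N - m))" for N
    by (subst suminf_finite[of "{..N}"]) auto
  moreover have "(\<Sum>m. f m * L) = (\<Sum>m. f m) * L"
    by (rule suminf_mult2[symmetric, OF summable_norm_cancel[OF f]])
  ultimately show ?thesis by simp
qed

lemma sum_triangle:
  fixes g :: "nat \<Rightarrow> nat \<Rightarrow> 'a :: comm_monoid_add"
  shows "(\<Sum>k\<le>n. \<Sum>j\<le>k. g j (k - j)) = (\<Sum>j\<le>n. \<Sum>l\<le>n - j. g j l)"
  by (simp add: sum.Sigma)
     (rule sum.reindex_bij_witness[of _ "\<lambda>(j, l). (j + l, j)" "\<lambda>(k, j). (j, k - j)"]; auto)

lemma sum_triangle_swap: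
  fixes g :: "nat \<Rightarrow> nat \<Rightarrow> 'a :: comm_monoid_add"
  shows "(\<Sum>m\<le>n. \<Sum>j\<le>n - m. g m j) = (\<Sum>j\<le>n. \<Sum>m\<le>n - j. g m j)"
  by (simp add: sum.Sigma)
     (rule sum.reindex_bij_witness[of _ "\<lambda>(j, l). (l, j)" "\<lambda>(k, j). (j, k)"]; auto)

text \<open>Regroups a product of three power series, truncated at total degree \<open>N\<close>, so
  that the first factor is convolved with the third while the index of the second stays
  outermost.\<close>

lemma sum_triangle_assoc:
  fixes F :: "nat \<Rightarrow> nat \<Rightarrow> nat \<Rightarrow> 'a :: comm_monoid_add"
  shows "(\<Sum>m\<le>N. \<Sum>k\<le>N - m. \<Sum>j\<le>k. F m j (k - j)) = (\<Sum>j\<le>N. \<Sum>s\<le>N - j. \<Sum>l\<le>s. F (s - l) j l)"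
proof -
  have "(\<Sum>m\<le>N. \<Sum>k\<le>N - m. \<Sum>j\<le>k. F m j (k - j)) = (\<Sum>m\<le>N. \<Sum>j\<le>N - m. \<Sum>l\<le>N - m - j. F m j l)"
    by (simp add: sum_triangle)
  also have "\<dots> = (\<Sum>j\<le>N. \<Sum>m\<le>N - j. \<Sum>l\<le>N - m - j. F m j l)"
    by (rule sum_triangle_swap)
  also have "\<dots> = (\<Sum>j\<le>N. \<Sum>m\<le>N - j. \<Sum>l\<le>N - j - m. F m j l)"
    by (intro sum.cong refl) (simp_all add: add.commute)
  also have "\<dots> = (\<Sum>j\<le>N. \<Sum>l\<le>N - j. \<Sum>m\<le>N - j - l. F m j l)"
    by (intro sum.cong refl sum_triangle_swap)
  also have "\<dots> = (\<Sum>j\<le>N. \<Sum>s\<le>N - j. \<Sum>l\<le>s. F (s - l) j l)"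
    by (intro sum.cong refl sum_triangle[symmetric, of "\<lambda>l m. F m j l" for j])
  finally show ?thesis .
qed

text \<open>The geometric bound makes the double family absolutely summable, so Fubini applies; it
  also leaves geometric decay for the column sums.\<close>

lemma sums_swap_geometric:
  fixes f :: "nat \<Rightarrow> nat \<Rightarrow> complex"
  assumes bound: "\<And>i m. norm (f i m) \<le> C * s ^ i * t ^ m"
      and s: "0 \<le> s" "s < 1" and t: "0 \<le> t" "t < 1"
      and rows: "\<And>i. f i sums R i" and cols: "\<And>m. (\<lambda>i. f i m) sums c m"
      and total: "R sums S"
  shows "c sums S" and "norm (c m) \<le> C / (1 - s) * t ^ m"
proof -
  have C: "0 \<le> C"
    using bound[of 0 0] norm_ge_zero order_trans by (metis mult.right_neutral power_0)
  have gs: "summable (\<lambda>i. s ^ i)" and gt: "summable (\<lambda>i. t ^ i)"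
    using s t by (auto intro!: summable_geometric)
  have abs: "(\<lambda>p. norm (case p of (i, m) \<Rightarrow> f i m)) summable_on UNIV \<times> UNIV"
  proof (rule Infinite_Sum.abs_summable_on_comparison_test')
    have "(\<lambda>(i, m). (C * s ^ i) * t ^ m) summable_on UNIV \<times> UNIV"
    proof (rule summable_on_SigmaI[where g = "\<lambda>i. C * s ^ i * (1 / (1 - t))"], goal_cases)
      case (1 i)
      have "((\<lambda>m. C * s ^ i * t ^ m) has_sum (C * s ^ i * (1 / (1 - t)))) UNIV"
        using t gt by (intro has_sum_cmult_right norm_summable_imp_has_sum geometric_sums) (auto simp: norm_power)
      thus ?case by simp
    next
      case 2
      show ?case
        using s gs by (intro summable_on_cmult_left summable_on_cmult_right norm_summable_imp_summable_on)
          (auto simp: norm_power)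
    qed (use C s t in auto)
    thus "(\<lambda>(i, m). (C * s ^ i) * t ^ m) summable_on UNIV \<times> UNIV" .
  qed (use bound in auto)
  have row_abs: "summable (\<lambda>m. norm (f i m))" for i
    by (rule summable_comparison_test'[of "\<lambda>m. C * s ^ i * t ^ m"]) (use bound gt in auto)
  have row_sum: "(f i has_sum R i) UNIV" for i
    by (rule norm_summable_imp_has_sum[OF row_abs rows])
  have col_abs: "summable (\<lambda>i. norm (f i m))" for m
    by (rule summable_comparison_test'[of "\<lambda>i. C * s ^ i * t ^ m"])
       (use bound gs in \<open>auto intro!: summable_mult summable_mult2\<close>)
  have col_sum: "((\<lambda>i. f i m) has_sum c m) UNIV" for m
    by (rule norm_summable_imp_has_sum[OF col_abs cols])
  show bound_c: "norm (c m) \<le> C / (1 - s) * t ^ m" for m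
  proof -
    have "norm (c m) \<le> (\<Sum>i. norm (f i m))"
      using summable_norm[OF col_abs[of m]] cols[of m] by (simp add: sums_iff)
    also have "\<dots> \<le> (\<Sum>i. C * t ^ m * s ^ i)"
      by (intro suminf_le col_abs summable_mult gs) (use bound[of _ m] in \<open>simp add: mult_ac\<close>)
    also have "\<dots> = C * t ^ m * (1 / (1 - s))"
      using s by (subst suminf_mult[OF gs]) (auto simp: suminf_geometric)
    finally show ?thesis by (simp add: mult_ac)
  qed
  have sumF: "(\<lambda>(i, m). f i m) summable_on UNIV \<times> UNIV"
    by (rule Infinite_Sum.abs_summable_summable[OF abs])
  have "summable (\<lambda>m. norm (c m))"
    by (rule summable_comparison_test'[of "\<lambda>m. C / (1 - s) * t ^ m"]) (use bound_c gt in auto)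
  moreover have "summable c"
    using calculation by (rule summable_norm_cancel)
  ultimately have "(c has_sum (\<Sum>m. c m)) UNIV"
    by (intro norm_summable_imp_has_sum summable_sums)
  hence "(\<Sum>m. c m) = (\<Sum>\<^sub>\<infinity>m. \<Sum>\<^sub>\<infinity>i. f i m)"
    using col_sum by (metis (no_types, lifting) infsumI infsum_cong)
  also have "\<dots> = (\<Sum>\<^sub>\<infinity>i. \<Sum>\<^sub>\<infinity>m. f i m)"
    by (rule infsum_swap_banach[symmetric, OF sumF])
  also have "\<dots> = infsum R UNIV"
    using row_sum by (metis (no_types, lifting) infsumI infsum_cong)
  also have "(R has_sum infsum R UNIV) UNIV"
  proof -
    have "infsum (f i) UNIV = R i" for i
      by (rule infsumI[OF row_sum])
    hence "R summable_on UNIV"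
      using summable_on_Sigma_banach[OF sumF] by simp
    thus ?thesis
      by (rule has_sum_infsum)
  qed
  hence "infsum R UNIV = S"
    using total has_sum_imp_sums sums_unique2 by blast
  finally show "c sums S"
    using \<open>summable c\<close> by (simp add: sums_iff)
qed

section \<open>Taylor coefficients of entire functions\<close>

lemma entire_sums:
  assumes "f holomorphic_on UNIV"
  shows "(\<lambda>m. fps_nth (fps_expansion f 0) m * x ^ m) sums f x"
proof -
  have "f holomorphic_on ball 0 (norm x + 1)"
    by (rule holomorphic_on_subset[OF assms]) auto
  thus ?thesis
    using holomorphic_power_series[of f 0 "norm x + 1" x] by (simp add: fps_expansion_def)
qed

lemma norm_fps_expansion_le:
  assumes "f holomorphic_on UNIV" "r > 0" "\<And>x. norm x = r \<Longrightarrow> norm (f x) \<le> B"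
  shows "norm (fps_nth (fps_expansion f 0) m) \<le> B / r ^ m"
proof -
  have "norm ((deriv ^^ m) f 0) \<le> fact m * B / r ^ m"
    using assms holomorphic_on_subset[OF assms(1)]
    by (intro Cauchy_inequality) (auto intro!: holomorphic_on_imp_continuous_on)
  thus ?thesis
    by (simp add: fps_expansion_def norm_divide field_simps)
qed

section \<open>Lambert series\<close>

lemma exp_minus_1_le: "exp u - 1 \<le> u * exp (u::real)"
proof -
  have "(1 - u) * exp u \<le> exp (- u) * exp u"
    using exp_ge_add_one_self[of "- u"] by (intro mult_right_mono) auto
  thus ?thesis
    by (simp add: exp_minus algebra_simps)
qed

definition lambert :: "complex \<Rightarrow> complex \<Rightarrow> complex" where
  "lambert w q = (\<Sum>j. w * q ^ j / (1 - w * q ^ j))"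

context
  fixes q :: complex
  assumes q: "norm q < 1"
begin

text \<open>The inequality \<open>exp u - 1 \<le> u * exp u\<close> extracts the decay
  \<open>norm q ^ i\<close>.\<close>

lemma norm_qpoch_inf_power_diff_1_le:
  "norm (qpoch_inf (w * q ^ i) q - 1) \<le>
     norm w / (1 - norm q) * exp (norm w / (1 - norm q)) * norm q ^ i"
proof -
  have "norm (qpoch_inf (w * q ^ i) q - 1) \<le> exp (norm (w * q ^ i) / (1 - norm q)) - 1"
    by (rule norm_qpoch_inf_diff_1_le[OF q])
  also have "\<dots> \<le> norm (w * q ^ i) / (1 - norm q) * exp (norm (w * q ^ i) / (1 - norm q))"
    by (rule exp_minus_1_le)
  also have "\<dots> \<le> norm (w * q ^ i) / (1 - norm q) * exp (norm w / (1 - norm q))"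
    using q norm_mult_power_le[OF q, of w i]
    by (intro mult_left_mono) (auto intro!: divide_right_mono divide_nonneg_nonneg)
  finally show ?thesis
    by (simp add: norm_mult norm_power mult_ac)
qed

lemma norm_qpoch_inf_power_diff_le:
  "norm (qpoch_inf (v * q ^ i) q - qpoch_inf (w * q ^ i) q) \<le>
     (norm v / (1 - norm q) * exp (norm v / (1 - norm q)) +
      norm w / (1 - norm q) * exp (norm w / (1 - norm q))) * norm q ^ i"
proof -
  have "norm ((qpoch_inf (v * q ^ i) q - 1) - (qpoch_inf (w * q ^ i) q - 1)) \<le>
      norm (qpoch_inf (v * q ^ i) q - 1) + norm (qpoch_inf (w * q ^ i) q - 1)"
    by (rule norm_triangle_ineq4)
  also have "\<dots> \<le> (norm v / (1 - norm q) * exp (norm v / (1 - norm q))) * norm q ^ i +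
      (norm w / (1 - norm q) * exp (norm w / (1 - norm q))) * norm q ^ i"
    by (intro add_mono norm_qpoch_inf_power_diff_1_le)
  finally show ?thesis
    by (simp add: distrib_right)
qed

lemma inverse_qpoch_inf_power:
  assumes "qpoch_inf w q \<noteq> 0"
  shows "1 / qpoch_inf (w * q ^ i) q = qpoch w q i / qpoch_inf w q"
  using qpoch_inf_split[OF q, of w i] assms by (auto simp: field_simps)

text \<open>Replacing \<open>w\<close> by \<open>w q^n\<close> in the second series gives values
  \<open>h n\<close> whose consecutive differences are q-binomial sums equal to
  \<open>w q^n / (1 - w q^n)\<close>; these telescope. The added constant is the limit of
  \<open>h\<close>, independent of \<open>w\<close>, and cancels when two such evaluations are
  subtracted.\<close>

lemma lambert_sums:
  assumes w: "qpoch_inf w q \<noteq> 0"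
  shows "(\<lambda>j. w * q ^ j / (1 - w * q ^ j)) sums lambert w q"
    and "(\<lambda>i. qpoch_inf (q * q ^ i) q / qpoch_inf (w * q ^ i) q - 1) sums
      (lambert w q + (\<Sum>i. qpoch_inf (q * q ^ i) q - 1))"
proof -
  define T where "T = (\<lambda>n i. qpoch_inf (q * q ^ i) q / qpoch_inf (w * q ^ n * q ^ i) q - 1)"
  define h where "h = (\<lambda>n. \<Sum>i. T n i)"
  define E where "E = exp (norm w / (1 - norm q))"
  \<comment> \<open>\<open>D\<close> and \<open>E\<close> are independent of \<open>n\<close>
    because \<open>norm (w * q ^ n) \<le> norm w\<close>; this provides the majorant for Tannery's
    theorem.\<close>
  define D where "D = norm q / (1 - norm q) * exp (norm q / (1 - norm q)) + norm w / (1 - norm q) * E"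
  have nz: "qpoch_inf (w * q ^ n) q \<noteq> 0" for n
    using w qpoch_inf_split[OF q, of w n] by auto
  have nz': "qpoch_inf (w * q ^ n * q ^ i) q \<noteq> 0" for n i
    using nz[of "n + i"] by (simp add: power_add mult.assoc)
  have T_bound: "norm (T n i) \<le> D * (E / norm (qpoch_inf w q)) * norm q ^ i" for n i
  proof -
    have eq: "T n i = (qpoch_inf (q * q ^ i) q - qpoch_inf (w * q ^ n * q ^ i) q) *
        (1 / qpoch_inf (w * q ^ (n + i)) q)"
      using nz'[of n i] by (simp add: T_def power_add mult.assoc diff_divide_distrib)
    have "norm (qpoch_inf (q * q ^ i) q - qpoch_inf (w * q ^ n * q ^ i) q) \<le>
      (norm q / (1 - norm q) * exp (norm q / (1 - norm q)) +
       norm (w * q ^ n) / (1 - norm q) * exp (norm (w * q ^ n) / (1 - norm q))) * norm q ^ i"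
      by (rule norm_qpoch_inf_power_diff_le)
    also have "\<dots> \<le> D * norm q ^ i"
      unfolding D_def E_def using norm_mult_power_le[OF q, of w n] q
      by (intro mult_right_mono add_mono mult_mono)
         (auto intro!: divide_right_mono divide_nonneg_nonneg)
    finally have 1: "norm (qpoch_inf (q * q ^ i) q - qpoch_inf (w * q ^ n * q ^ i) q) \<le> D * norm q ^ i" .
    have "norm (1 / qpoch_inf (w * q ^ (n + i)) q) \<le> E / norm (qpoch_inf w q)"
      unfolding inverse_qpoch_inf_power[OF w] norm_divide E_def
      by (intro divide_right_mono norm_qpoch_le[OF q]) auto
    hence "norm (T n i) \<le> (D * norm q ^ i) * (E / norm (qpoch_inf w q))"
      unfolding eq norm_mult using 1 by (intro mult_mono) (auto intro: order_trans[OF norm_ge_zero])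
    thus ?thesis by (simp add: mult_ac)
  qed
  have gs: "summable (\<lambda>i. D * (E / norm (qpoch_inf w q)) * norm q ^ i)"
    using q by (intro summable_mult summable_geometric) auto
  have T_summable: "summable (T n)" for n
    by (rule summable_comparison_test'[OF gs]) (rule T_bound)
  have w_ne: "w * q ^ n \<noteq> 1" for n
    using w by (auto simp: qpoch_inf_eq_0_iff[OF q])
  have step: "h n - h (Suc n) = w * q ^ n / (1 - w * q ^ n)" for n
  proof -
    define v where "v = w * q ^ n"
    have v: "v \<noteq> 1" "qpoch_inf v q \<noteq> 0" "qpoch_inf (v * q) q \<noteq> 0"
      using w_ne[of n] nz[of n] nz[of "Suc n"] by (simp_all add: v_def mult_ac)
    have "(\<lambda>i. T n i - T (Suc n) i) sums (h n - h (Suc n))"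
      unfolding h_def by (intro sums_diff summable_sums T_summable)
    moreover have "T n i - T (Suc n) i =
        v * (qpoch_inf q q / qpoch_inf v q) * (qpoch v q i / qpoch q q i * q ^ i)" for i
    proof -
      have 1: "qpoch_inf (v * q ^ i) q = (1 - v * q ^ i) * qpoch_inf (v * q * q ^ i) q"
        using qpoch_inf_rec[OF q, of "v * q ^ i"] by (simp add: mult_ac)
      have ne: "qpoch_inf (v * q ^ i) q \<noteq> 0"
        using nz'[of n i] by (simp add: v_def)
      have "T n i - T (Suc n) i =
          qpoch_inf (q * q ^ i) q * (1 / qpoch_inf (v * q ^ i) q - 1 / qpoch_inf (v * q * q ^ i) q)"
        by (simp add: T_def v_def mult_ac diff_divide_distrib algebra_simps)
      also have "1 / qpoch_inf (v * q ^ i) q - 1 / qpoch_inf (v * q * q ^ i) q =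
          v * q ^ i * (1 / qpoch_inf (v * q ^ i) q)"
        using ne unfolding 1 by (simp add: field_simps)
      also have "1 / qpoch_inf (v * q ^ i) q = qpoch v q i / qpoch_inf v q"
        by (rule inverse_qpoch_inf_power) (rule v)
      also have "qpoch_inf (q * q ^ i) q = qpoch_inf q q / qpoch q q i"
        using qpoch_inf_split[OF q, of q i] qpoch_base_nonzero[OF q, of i] by simp
      finally show ?thesis by (simp add: mult_ac)
    qed
    ultimately have "(\<lambda>i. v * (qpoch_inf q q / qpoch_inf v q) * (qpoch v q i / qpoch q q i * q ^ i)) sums
        (h n - h (Suc n))"
      by simp
    moreover have "(\<lambda>i. v * (qpoch_inf q q / qpoch_inf v q) * (qpoch v q i / qpoch q q i * q ^ i)) sums
        (v * (qpoch_inf q q / qpoch_inf v q) * (qpoch_inf (v * q) q / qpoch_inf q q))"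
      by (intro sums_mult q_binomial q)
    ultimately have "h n - h (Suc n) =
        v * (qpoch_inf q q / qpoch_inf v q) * (qpoch_inf (v * q) q / qpoch_inf q q)"
      by (rule sums_unique2)
    also have "\<dots> = v / (1 - v)"
      using v qpoch_inf_small_nonzero[OF q q] by (simp add: qpoch_inf_rec[OF q, of v])
    finally show ?thesis by (simp add: v_def)
  qed
  \<comment> \<open>As \<open>n\<close> grows, the denominators
    \<open>qpoch_inf (w * q ^ n * q ^ i) q\<close> tend to 1.\<close>
  have "h \<longlonglongrightarrow> (\<Sum>i. qpoch_inf (q * q ^ i) q - 1)"
    unfolding h_def
  proof (intro tannerys_theorem[THEN conjunct2, THEN conjunct2])
    show "(\<lambda>n. T n i) \<longlonglongrightarrow> qpoch_inf (q * q ^ i) q - 1" for i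
    proof -
      have "T n i = qpoch_inf (q * q ^ i) q * (qpoch w q (n + i) / qpoch_inf w q) - 1" for n
        unfolding inverse_qpoch_inf_power[OF w, symmetric] by (simp add: T_def power_add mult.assoc)
      moreover have "(\<lambda>n. qpoch_inf (q * q ^ i) q * (qpoch w q (n + i) / qpoch_inf w q) - 1)
          \<longlonglongrightarrow> qpoch_inf (q * q ^ i) q * (qpoch_inf w q / qpoch_inf w q) - 1"
        by (intro tendsto_intros LIMSEQ_ignore_initial_segment qpoch_tendsto q w)
      ultimately show ?thesis
        using w by simp
    qed
    show "eventually (\<lambda>(i, n). norm (T n i) \<le> D * (E / norm (qpoch_inf w q)) * norm q ^ i)
        (sequentially \<times>\<^sub>F sequentially)"
      by (intro always_eventually) (use T_bound in auto)
  qed (use gs in auto)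
  hence "(\<lambda>n. h n - h (Suc n)) sums (h 0 - (\<Sum>i. qpoch_inf (q * q ^ i) q - 1))"
    by (rule telescope_sums')
  hence lam: "(\<lambda>j. w * q ^ j / (1 - w * q ^ j)) sums (h 0 - (\<Sum>i. qpoch_inf (q * q ^ i) q - 1))"
    unfolding step .
  thus "(\<lambda>j. w * q ^ j / (1 - w * q ^ j)) sums lambert w q"
    unfolding lambert_def by (simp add: sums_iff)
  have "lambert w q = h 0 - (\<Sum>i. qpoch_inf (q * q ^ i) q - 1)"
    using lam by (simp add: lambert_def sums_iff)
  thus "(\<lambda>i. qpoch_inf (q * q ^ i) q / qpoch_inf (w * q ^ i) q - 1) sums
      (lambert w q + (\<Sum>i. qpoch_inf (q * q ^ i) q - 1))"
    using summable_sums[OF T_summable[of 0]] by (simp add: h_def T_def)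
qed

end

section \<open>The \<open>q\<close>-Gauss kernel\<close>

text \<open>Euler's coefficients \<open>(-1)^m q^(m(m-1)/2) / (q;q)_m\<close>, introduced as Taylor
  coefficients at 0.\<close>

definition qpoch_coeff :: "complex \<Rightarrow> nat \<Rightarrow> complex" where
  "qpoch_coeff q m = fps_nth (fps_expansion (\<lambda>x. qpoch_inf x q) 0) m"

lemma qpoch_coeff_sums:
  assumes "norm q < 1"
  shows "(\<lambda>m. qpoch_coeff q m * x ^ m) sums qpoch_inf x q"
  unfolding qpoch_coeff_def by (rule entire_sums) (rule holomorphic_qpoch_inf[OF assms])

context
  fixes q :: complex
  assumes q0: "q \<noteq> 0" and q: "norm q < 1"
begin

text \<open>The q-binomial theorem at argument \<open>q ^ N\<close>. On the left \<open>N\<close>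
  enters through \<open>q ^ (N * i)\<close> alone, so for \<open>N = 2 * j + l\<close> a subsequent
  sum over \<open>l\<close> is again of q-binomial type.\<close>

lemma pochhammer_quotient_sums:
  assumes y: "qpoch_inf y q \<noteq> 0" and N: "N \<ge> 1"
  shows "(\<lambda>i. qpoch_inf q q / qpoch_inf y q * (qpoch y q i / qpoch q q i * q ^ (N * i))) sums
    (qpoch q q (N - 1) / qpoch y q N)"
proof -
  obtain M where M: "N = Suc M" using N by (cases N) auto
  have "norm (q ^ N) < 1"
    using q q0 N by (simp add: norm_power power_less_one_iff)
  hence "(\<lambda>i. qpoch y q i / qpoch q q i * (q ^ N) ^ i) sums (qpoch_inf (y * q ^ N) q / qpoch_inf (q ^ N) q)"
    by (rule q_binomial[OF q])
  hence "(\<lambda>i. qpoch_inf q q / qpoch_inf y q * (qpoch y q i / qpoch q q i * (q ^ N) ^ i)) sums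
      (qpoch_inf q q / qpoch_inf y q * (qpoch_inf (y * q ^ N) q / qpoch_inf (q ^ N) q))"
    by (rule sums_mult)
  moreover have "qpoch_inf q q / qpoch_inf y q * (qpoch_inf (y * q ^ N) q / qpoch_inf (q ^ N) q) =
      qpoch q q (N - 1) / qpoch y q N"
    using y qpoch_inf_split[OF q, of q M] qpoch_inf_split[OF q, of y N] qpoch_inf_small_nonzero[OF q q]
    by (simp add: M field_simps)
  ultimately show ?thesis
    by (simp add: power_mult)
qed

end

text \<open>In the application \<open>A = 1 / d\<close>, \<open>y = d q\<close>,
  \<open>z = q c^2\<close> with \<open>d = c\<close> or \<open>d = - c\<close>. The relation
  \<open>z * A = y\<close> makes \<open>z\<close> the argument at which the q-Gauss sum has a closed
  form.\<close>

locale q_gauss =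
  fixes q A y z :: complex
  assumes q0: "q \<noteq> 0" and q: "norm q < 1"
    and z0: "z \<noteq> 0" and zA: "z * A = y"
    and y_nz: "qpoch_inf y q \<noteq> 0" and z_nz: "qpoch_inf z q \<noteq> 0"
begin

abbreviation "\<phi> \<equiv> qpoch_coeff q"

text \<open>The kernel of the derived WP-Bailey relation as a function of \<open>j\<close> and \<open>n - j\<close>. The case \<open>n = 0\<close>,
  where \<open>n + j - 1\<close> would be truncated, is set to \<open>0\<close>.\<close>
definition kern :: "nat \<Rightarrow> nat \<Rightarrow> complex" where
  "kern j l = (if j = 0 \<and> l = 0 then 0
     else qpoch A q l / qpoch q q l * (qpoch q q (2 * j + l - 1) / qpoch y q (2 * j + l)))"

definition kern_conv :: "nat \<Rightarrow> nat \<Rightarrow> complex" where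
  "kern_conv j m = (\<Sum>l\<le>m. \<phi> (m - l) * kern j l)"

text \<open>This is \<open>(x;q)_inf (A x q^i;q)_inf / (x q^i;q)_inf\<close> after cancellation, a
  form that is visibly entire.\<close>

definition H :: "nat \<Rightarrow> complex \<Rightarrow> complex" where
  "H i x = qpoch x q i * qpoch_inf (A * x * q ^ i) q"

definition h :: "nat \<Rightarrow> nat \<Rightarrow> complex" where
  "h i m = fps_nth (fps_expansion (H i) 0) m"

text \<open>A radius beyond \<open>norm z\<close>: Cauchy's estimate on this circle makes
  coefficients times \<open>z ^ m\<close> decay like \<open>(1 / 2) ^ m\<close>.\<close>

definition r where "r = 2 * norm z"

lemma r_pos: "r > 0"
  using z0 by (simp add: r_def)

lemma holomorphic_H: "H i holomorphic_on S"
  unfolding H_def qpoch_def by (intro holomorphic_intros holomorphic_qpoch_inf'[OF q])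

lemma h_sums: "(\<lambda>m. h i m * x ^ m) sums H i x"
  unfolding h_def by (rule entire_sums) (rule holomorphic_H)

text \<open>Near 0, \<open>H i\<close> is the product of \<open>(x;q)_inf\<close> and the q-binomial
  series at \<open>x q^i\<close>; Taylor coefficients are unique.\<close>

lemma h_eq: "h i m = (\<Sum>l\<le>m. \<phi> (m - l) * (qpoch A q l / qpoch q q l * q ^ (i * l)))"
proof -
  define F where "F = Abs_fps (\<lambda>l. qpoch A q l / qpoch q q l * q ^ (i * l))"
  have hF: "(\<lambda>x. qpoch_inf (A * x * q ^ i) q / qpoch_inf (x * q ^ i) q) has_fps_expansion F"
  proof (rule has_fps_expansionI)
    have "eventually (\<lambda>x::complex. x \<in> ball 0 1) (nhds 0)"
      by (intro eventually_nhds_in_open) auto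
    thus "eventually (\<lambda>x. (\<lambda>n. fps_nth F n * x ^ n) sums
        (qpoch_inf (A * x * q ^ i) q / qpoch_inf (x * q ^ i) q)) (nhds 0)"
    proof eventually_elim
      case (elim x)
      have "norm (x * q ^ i) < 1"
        using norm_mult_power_le[OF q, of x i] elim by simp
      from q_binomial[OF q this, of A] show ?case
        by (simp add: F_def power_mult_distrib mult_ac flip: power_mult)
    qed
  qed
  have hphi: "(\<lambda>x. qpoch_inf x q) has_fps_expansion fps_expansion (\<lambda>x. qpoch_inf x q) 0"
    by (rule has_fps_expansion_fps_expansion[of UNIV]) (auto intro: holomorphic_qpoch_inf[OF q])
  have "H i has_fps_expansion (fps_expansion (\<lambda>x. qpoch_inf x q) 0 * F)"
  proof (rule has_fps_expansion_cong[THEN iffD1, OF _ refl])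
    show "(\<lambda>x. qpoch_inf x q * (qpoch_inf (A * x * q ^ i) q / qpoch_inf (x * q ^ i) q))
        has_fps_expansion (fps_expansion (\<lambda>x. qpoch_inf x q) 0 * F)"
      by (intro has_fps_expansion_mult hphi hF)
    have "eventually (\<lambda>x::complex. x \<in> ball 0 1) (nhds 0)"
      by (intro eventually_nhds_in_open) auto
    thus "eventually (\<lambda>x. qpoch_inf x q * (qpoch_inf (A * x * q ^ i) q / qpoch_inf (x * q ^ i) q) = H i x) (nhds 0)"
    proof eventually_elim
      case (elim x)
      have "norm (x * q ^ i) < 1"
        using norm_mult_power_le[OF q, of x i] elim by simp
      thus ?case
        using qpoch_inf_small_nonzero[OF q, of "x * q ^ i"] qpoch_inf_split[OF q, of x i]
        by (simp add: H_def)
    qed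
  qed
  hence "fps_expansion (H i) 0 = F * fps_expansion (\<lambda>x. qpoch_inf x q) 0"
    by (subst mult.commute) (rule fps_expansion_eqI)
  hence "h i m = (\<Sum>l\<le>m. fps_nth F l * \<phi> (m - l))"
    by (simp only: h_def fps_mult_nth qpoch_coeff_def atMost_atLeast0)
  thus ?thesis
    by (simp add: F_def mult_ac)
qed

lemma norm_H_le: "norm x = r \<Longrightarrow> norm (H i x) \<le> exp (r / (1 - norm q)) * exp (norm A * r / (1 - norm q))"
proof -
  assume x: "norm x = r"
  have "norm (qpoch_inf (A * x * q ^ i) q) \<le> exp (norm (A * x * q ^ i) / (1 - norm q))"
    by (rule norm_qpoch_inf_le[OF q])
  also have "\<dots> \<le> exp (norm A * r / (1 - norm q))"
    using norm_mult_power_le[OF q, of "A * x" i] q x by (auto intro!: divide_right_mono simp: norm_mult)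
  finally show ?thesis
    unfolding H_def norm_mult using norm_qpoch_le[OF q, of x i] x by (intro mult_mono) auto
qed

text \<open>For \<open>j = 0\<close> the factor \<open>q ^ (2 * j * i)\<close> gives no decay in
  \<open>i\<close>; the difference estimated here supplies it.\<close>

lemma norm_H_diff_le:
  "\<exists>C. \<forall>i x. norm x = r \<longrightarrow> norm (H i x - qpoch_inf x q) \<le> C * norm q ^ i"
proof -
  define C where "C = exp (r / (1 - norm q)) *
      (norm A * r / (1 - norm q) * exp (norm A * r / (1 - norm q)) + r / (1 - norm q) * exp (r / (1 - norm q)))"
  have "norm (H i x - qpoch_inf x q) \<le> C * norm q ^ i" if x: "norm x = r" for i x
  proof -
    have "H i x - qpoch_inf x q = qpoch x q i * (qpoch_inf (A * x * q ^ i) q - qpoch_inf (x * q ^ i) q)"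
      unfolding H_def by (subst qpoch_inf_split[OF q, of x i]) (simp add: algebra_simps)
    also have "norm \<dots> \<le> exp (norm x / (1 - norm q)) *
        ((norm (A * x) / (1 - norm q) * exp (norm (A * x) / (1 - norm q)) +
          norm x / (1 - norm q) * exp (norm x / (1 - norm q))) * norm q ^ i)"
      unfolding norm_mult[of "qpoch x q i"]
      by (intro mult_mono norm_qpoch_le[OF q] norm_qpoch_inf_power_diff_le[OF q]) auto
    also have "\<dots> = C * norm q ^ i"
      by (simp add: C_def x norm_mult mult_ac)
    finally show ?thesis .
  qed
  thus ?thesis by blast
qed

lemma norm_h_bounds:
  obtains C where "C \<ge> 0" "\<And>i m. norm (h i m) \<le> C / r ^ m"
    "\<And>i m. norm (h i m - \<phi> m) \<le> C * norm q ^ i / r ^ m"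
proof -
  define C1 where "C1 = exp (r / (1 - norm q)) * exp (norm A * r / (1 - norm q))"
  obtain C2 where C2: "\<And>i x. norm x = r \<Longrightarrow> norm (H i x - qpoch_inf x q) \<le> C2 * norm q ^ i"
    using norm_H_diff_le by blast
  define C where "C = max C1 C2"
  have 1: "norm (h i m) \<le> C / r ^ m" for i m
    unfolding h_def
    by (rule norm_fps_expansion_le[OF holomorphic_H r_pos], rule order_trans[OF norm_H_le])
       (auto simp: C_def C1_def)
  have 2: "norm (h i m - \<phi> m) \<le> C * norm q ^ i / r ^ m" for i m
  proof -
    have fps: "fps_expansion (\<lambda>x. H i x - qpoch_inf x q) 0 = fps_expansion (H i) 0 - fps_expansion (\<lambda>x. qpoch_inf x q) 0"
      by (intro fps_expansion_eqI has_fps_expansion_diff has_fps_expansion_fps_expansion[of UNIV])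
         (auto intro: holomorphic_qpoch_inf[OF q] holomorphic_H)
    have "norm (fps_nth (fps_expansion (\<lambda>x. H i x - qpoch_inf x q) 0) m) \<le> C * norm q ^ i / r ^ m"
    proof (rule norm_fps_expansion_le[OF _ r_pos])
      show "(\<lambda>x. H i x - qpoch_inf x q) holomorphic_on UNIV"
        by (intro holomorphic_intros holomorphic_H holomorphic_qpoch_inf[OF q])
      show "norm (H i x - qpoch_inf x q) \<le> C * norm q ^ i" if "norm x = r" for x
        by (rule order_trans[OF C2[OF that]]) (auto simp: C_def intro!: mult_right_mono)
    qed
    thus ?thesis
      unfolding fps by (simp add: h_def qpoch_coeff_def)
  qed
  have "C \<ge> 0"
    by (simp add: C_def C1_def le_max_iff_disj)
  with 1 2 show ?thesis
    using that by blast
qed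

abbreviation "Q0 \<equiv> qpoch_inf q q / qpoch_inf y q"
abbreviation "e i \<equiv> qpoch y q i / qpoch q q i"

text \<open>The \<open>i\<close>-th term of \<open>kern_conv j m\<close> once the Pochhammer
  quotients are expanded. The subtraction for \<open>j = 0\<close> reflects
  \<open>kern 0 0 = 0\<close>.\<close>

definition kern_term :: "nat \<Rightarrow> nat \<Rightarrow> nat \<Rightarrow> complex" where
  "kern_term j i m = Q0 * e i * q ^ (2 * j * i) * (h i m - (if j = 0 then \<phi> m else 0))"

lemma kern_term_sums: "(\<lambda>i. kern_term j i m) sums kern_conv j m"
proof -
  define c where "c = (\<lambda>l. if j = 0 \<and> l = 0 then 0 else \<phi> (m - l) * (qpoch A q l / qpoch q q l))"
  have "(\<lambda>i. c l * (Q0 * (e i * q ^ ((2 * j + l) * i)))) sums (\<phi> (m - l) * kern j l)" for l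
  proof (cases "j = 0 \<and> l = 0")
    case False
    hence "(\<lambda>i. c l * (Q0 * (e i * q ^ ((2 * j + l) * i)))) sums
        (c l * (qpoch q q (2 * j + l - 1) / qpoch y q (2 * j + l)))"
      by (intro sums_mult pochhammer_quotient_sums[OF q0 q y_nz]) auto
    moreover have "c l = \<phi> (m - l) * (qpoch A q l / qpoch q q l)"
      "kern j l = qpoch A q l / qpoch q q l * (qpoch q q (2 * j + l - 1) / qpoch y q (2 * j + l))"
      using False by (simp_all only: c_def kern_def if_False)
    ultimately show ?thesis
      by (simp add: mult.assoc)
  qed (simp add: c_def kern_def)
  hence "(\<lambda>i. \<Sum>l\<le>m. c l * (Q0 * (e i * q ^ ((2 * j + l) * i)))) sums kern_conv j m"
    unfolding kern_conv_def by (intro sums_sum) auto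
  moreover have "(\<Sum>l\<le>m. c l * (Q0 * (e i * q ^ ((2 * j + l) * i)))) = kern_term j i m" for i
  proof -
    have "(\<Sum>l\<le>m. c l * q ^ (i * l)) = h i m - (if j = 0 then \<phi> m else 0)"
    proof -
      have "(\<Sum>l\<le>m. c l * q ^ (i * l)) =
          (\<Sum>l\<le>m. \<phi> (m - l) * (qpoch A q l / qpoch q q l * q ^ (i * l)) - (if l = 0 then (if j = 0 then \<phi> m else 0) else 0))"
        by (intro sum.cong refl) (auto simp: c_def)
      thus ?thesis
        by (simp add: h_eq sum_subtractf)
    qed
    moreover have "(\<Sum>l\<le>m. c l * (Q0 * (e i * q ^ ((2 * j + l) * i)))) =
        Q0 * e i * q ^ (2 * j * i) * (\<Sum>l\<le>m. c l * q ^ (i * l))"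
      unfolding sum_distrib_left by (intro sum.cong refl) (simp add: power_add distrib_left distrib_right mult_ac)
    ultimately show ?thesis
      by (simp add: kern_term_def)
  qed
  ultimately show ?thesis by simp
qed

text \<open>The constant is uniform in \<open>j\<close>: the decay in \<open>i\<close> comes from
  \<open>q ^ (2 * j * i)\<close> for \<open>j \<ge> 1\<close> and from the difference estimate for
  \<open>j = 0\<close>.\<close>

lemma kern_term_bound:
  obtains C where "C \<ge> 0" "\<And>j i m. norm (kern_term j i m * z ^ m) \<le> C * norm q ^ i * (1 / 2) ^ m"
proof -
  obtain C1 where C1: "C1 \<ge> 0" "\<And>i m. norm (h i m) \<le> C1 / r ^ m"
    "\<And>i m. norm (h i m - \<phi> m) \<le> C1 * norm q ^ i / r ^ m"
    by (rule norm_h_bounds) blast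
  obtain C2 where C2: "C2 > 0" "\<And>i. norm (e i) \<le> C2"
    using norm_qpoch_ratio_bounded[OF q, of y] by blast
  have bd: "norm (q ^ (2 * j * i) * (h i m - (if j = 0 then \<phi> m else 0))) \<le> norm q ^ i * (C1 / r ^ m)" for j i m
  proof (cases "j = 0")
    case True
    thus ?thesis using C1(3)[of i m] by (simp add: mult_ac)
  next
    case False
    have "norm q ^ (2 * j * i) \<le> norm q ^ i"
      using False q by (intro power_decreasing) auto
    thus ?thesis
      using False C1(2)[of i m] unfolding norm_mult norm_power by (intro mult_mono) auto
  qed
  have "norm (kern_term j i m * z ^ m) \<le> norm Q0 * C2 * C1 * norm q ^ i * (1 / 2) ^ m" for j i m
  proof -
    have "norm (kern_term j i m * z ^ m) =
        norm Q0 * norm (e i) * norm (q ^ (2 * j * i) * (h i m - (if j = 0 then \<phi> m else 0))) * norm z ^ m"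
      by (simp only: kern_term_def norm_mult norm_power mult_ac)
    also have "\<dots> \<le> norm Q0 * C2 * (norm q ^ i * (C1 / r ^ m)) * norm z ^ m"
      using C2 C1(1) r_pos by (intro mult_right_mono mult_mono bd) auto
    also have "\<dots> = norm Q0 * C2 * C1 * norm q ^ i * (norm z / r) ^ m"
      by (simp add: power_divide)
    also have "norm z / r = 1 / 2"
      using z0 by (simp add: r_def)
    finally show ?thesis .
  qed
  thus ?thesis
    using that[of "norm Q0 * C2 * C1"] C1(1) C2(1) by simp
qed

text \<open>For \<open>norm z < 1\<close> this is the sum of \<open>kern j l * z ^ l\<close> over
  \<open>l\<close>: the q-Gauss value for \<open>j \<ge> 1\<close>, and its Lambert series
  substitute for \<open>j = 0\<close>, where the term \<open>l = 0\<close> is left out.\<close>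

definition weight :: "nat \<Rightarrow> complex" where
  "weight j = (if j = 0 then lambert z q - lambert y q else qpoch q q (2 * j - 1) / qpoch z q (2 * j))"

lemma kern_rows_sums:
  "(\<lambda>i. Q0 * e i * q ^ (2 * j * i) * (H i z - (if j = 0 then qpoch_inf z q else 0))) sums
     (qpoch_inf z q * weight j)"
proof -
  have y_nz': "qpoch y q i \<noteq> 0" "qpoch_inf (y * q ^ i) q \<noteq> 0" for i
    using y_nz qpoch_inf_split[OF q, of y i] by auto
  \<comment> \<open>By \<open>z * A = y\<close>, the infinite product in \<open>H i z\<close>
    completes \<open>qpoch y q i\<close> to \<open>qpoch_inf y q\<close>, which cancels the
    denominator of \<open>Q0\<close>.\<close>
  have H: "Q0 * e i * H i z = qpoch_inf q q * (qpoch z q i / qpoch q q i)" for i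
    using y_nz' qpoch_inf_split[OF q, of y i] zA qpoch_base_nonzero[OF q]
    by (simp add: H_def mult.commute[of A])
  show ?thesis
  proof (cases "j = 0")
    case False
    have "norm (q ^ (2 * j)) < 1"
      using q False by (simp add: norm_power power_less_one_iff)
    hence "(\<lambda>i. qpoch_inf q q * (qpoch z q i / qpoch q q i * (q ^ (2 * j)) ^ i)) sums
        (qpoch_inf q q * (qpoch_inf (z * q ^ (2 * j)) q / qpoch_inf (q ^ (2 * j)) q))"
      by (intro sums_mult q_binomial q)
    moreover have "qpoch_inf q q * (qpoch_inf (z * q ^ (2 * j)) q / qpoch_inf (q ^ (2 * j)) q) =
        qpoch_inf z q * weight j"
    proof -
      obtain M where M: "2 * j = Suc M"
        using False by (cases "2 * j") auto
      show ?thesis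
        using False qpoch_inf_split[OF q, of q M] qpoch_inf_split[OF q, of z "2 * j"] z_nz
          qpoch_inf_small_nonzero[OF q q] unfolding weight_def M by (simp add: field_simps)
    qed
    moreover have "Q0 * e i * q ^ (2 * j * i) * (H i z - (if j = 0 then qpoch_inf z q else 0)) =
        qpoch_inf q q * (qpoch z q i / qpoch q q i * (q ^ (2 * j)) ^ i)" for i
    proof -
      have "Q0 * e i * q ^ (2 * j * i) * (H i z - (if j = 0 then qpoch_inf z q else 0)) =
          (Q0 * e i * H i z) * q ^ (2 * j * i)"
        using False by simp
      thus ?thesis
        unfolding H by (simp add: mult.assoc flip: power_mult)
    qed
    ultimately show ?thesis by simp
  next
    case True
    \<comment> \<open>Both Lambert evaluations carry the same constant, so it drops out of the
      difference.\<close>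
    have "(\<lambda>i. qpoch_inf z q * ((qpoch_inf (q * q ^ i) q / qpoch_inf (z * q ^ i) q - 1) -
          (qpoch_inf (q * q ^ i) q / qpoch_inf (y * q ^ i) q - 1))) sums
        (qpoch_inf z q * ((lambert z q + (\<Sum>i. qpoch_inf (q * q ^ i) q - 1)) -
          (lambert y q + (\<Sum>i. qpoch_inf (q * q ^ i) q - 1))))"
      by (intro sums_mult sums_diff lambert_sums(2) q z_nz y_nz)
    moreover have "qpoch_inf z q * ((qpoch_inf (q * q ^ i) q / qpoch_inf (z * q ^ i) q - 1) -
          (qpoch_inf (q * q ^ i) q / qpoch_inf (y * q ^ i) q - 1)) = Q0 * e i * (H i z - qpoch_inf z q)" for i
    proof -
      have 1: "qpoch_inf (q * q ^ i) q = qpoch_inf q q / qpoch q q i"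
        using qpoch_inf_split[OF q, of q i] qpoch_base_nonzero[OF q, of i] by simp
      have "qpoch_inf z q * ((qpoch_inf (q * q ^ i) q / qpoch_inf (z * q ^ i) q - 1) -
          (qpoch_inf (q * q ^ i) q / qpoch_inf (y * q ^ i) q - 1)) =
          qpoch_inf z q * (qpoch_inf (q * q ^ i) q * (1 / qpoch_inf (z * q ^ i) q) -
          qpoch_inf (q * q ^ i) q * (1 / qpoch_inf (y * q ^ i) q))"
        by simp
      also have "\<dots> = qpoch_inf q q * (qpoch z q i / qpoch q q i) - Q0 * e i * qpoch_inf z q"
        unfolding 1 inverse_qpoch_inf_power[OF q z_nz] inverse_qpoch_inf_power[OF q y_nz]
        using z_nz by (simp add: field_simps)
      also have "\<dots> = Q0 * e i * (H i z - qpoch_inf z q)"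
        by (simp only: H[symmetric] right_diff_distrib)
      finally show ?thesis .
    qed
    ultimately show ?thesis
      using True by (simp add: weight_def)
  qed
qed

lemma kern_conv_sums:
  obtains C where "\<And>j. (\<lambda>m. kern_conv j m * z ^ m) sums (qpoch_inf z q * weight j)"
    "\<And>j m. norm (kern_conv j m * z ^ m) \<le> C * (1 / 2) ^ m"
proof -
  obtain C where C: "\<And>j i m. norm (kern_term j i m * z ^ m) \<le> C * norm q ^ i * (1 / 2) ^ m"
    by (rule kern_term_bound) blast
  have rows: "(\<lambda>m. kern_term j i m * z ^ m) sums
      (Q0 * e i * q ^ (2 * j * i) * (H i z - (if j = 0 then qpoch_inf z q else 0)))" for j i
  proof -
    have "(\<lambda>m. Q0 * e i * q ^ (2 * j * i) * (h i m * z ^ m - (if j = 0 then \<phi> m * z ^ m else 0))) sums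
        (Q0 * e i * q ^ (2 * j * i) * (H i z - (if j = 0 then qpoch_inf z q else 0)))"
      by (intro sums_mult sums_diff h_sums) (auto intro: qpoch_coeff_sums[OF q])
    moreover have "Q0 * e i * q ^ (2 * j * i) * (h i m * z ^ m - (if j = 0 then \<phi> m * z ^ m else 0)) =
        kern_term j i m * z ^ m" for m
      by (simp add: kern_term_def algebra_simps)
    ultimately show ?thesis by simp
  qed
  have cols: "(\<lambda>i. kern_term j i m * z ^ m) sums (kern_conv j m * z ^ m)" for j m
    by (intro sums_mult2 kern_term_sums)
  note swap = sums_swap_geometric[OF C norm_ge_zero q _ _ rows cols kern_rows_sums]
  show ?thesis
    using that[of "C / (1 - norm q)"] swap by auto
qed

end

section \<open>Transformation of possibly conditionally convergent series\<close>

context q_gauss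
begin

text \<open>The tail of the geometric majorant. Uniformity in \<open>j\<close> is what later allows
  the error to be treated as a convolution.\<close>

lemma kern_conv_partial_sums:
  obtains C where
    "\<And>j M. norm ((\<Sum>m\<le>M. kern_conv j m * z ^ m) - qpoch_inf z q * weight j) \<le> C * (1 / 2) ^ M"
proof -
  obtain C where C: "\<And>j. (\<lambda>m. kern_conv j m * z ^ m) sums (qpoch_inf z q * weight j)"
      "\<And>j m. norm (kern_conv j m * z ^ m) \<le> C * (1 / 2) ^ m"
    by (rule kern_conv_sums) blast
  have "norm ((\<Sum>m\<le>M. kern_conv j m * z ^ m) - qpoch_inf z q * weight j) \<le> C * (1 / 2) ^ M" for j M
  proof -
    define f where "f = (\<lambda>m. kern_conv j m * z ^ m)"
    have f: "f sums (qpoch_inf z q * weight j)"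
      unfolding f_def by (rule C(1))
    have "(\<lambda>m. f (m + Suc M)) sums (qpoch_inf z q * weight j - (\<Sum>m\<le>M. f m))"
      using f sums_iff_shift'[of f "Suc M"] by (simp add: lessThan_Suc_atMost)
    moreover have g: "(\<lambda>m. C * (1 / 2) ^ Suc M * (1 / 2) ^ m) sums (C * (1 / 2) ^ Suc M * (1 / (1 - 1 / 2)))"
      by (intro sums_mult geometric_sums) auto
    ultimately have "norm (qpoch_inf z q * weight j - (\<Sum>m\<le>M. f m)) \<le> C * (1 / 2) ^ Suc M * (1 / (1 - 1 / 2))"
    proof (rule norm_sums_le)
      show "norm (f (m + Suc M)) \<le> C * (1 / 2) ^ Suc M * (1 / 2) ^ m" for m
        using C(2)[of j "m + Suc M"] by (simp add: f_def power_add mult_ac)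
    qed
    thus ?thesis
      by (simp add: f_def norm_minus_commute)
  qed
  thus ?thesis
    using that by blast
qed

text \<open>For \<open>norm z \<ge> 1\<close> the summations cannot be exchanged, since \<open>\<Sum>n. kern j n * z ^ n\<close> may diverge.
  Multiplying the generating function of \<open>b\<close> by the entire function \<open>(x;q)\<^sub>\<infinity>\<close> removes the poles
  responsible for this; the factor \<open>(z;q)\<^sub>\<infinity> \<noteq> 0\<close> is cancelled at the end.\<close>
theorem kern_transform:
  assumes b: "\<And>n. b n = (\<Sum>j\<le>n. kern j (n - j) * u j)"
    and B: "(\<lambda>n. z ^ n * b n) sums B"
    and W: "(\<lambda>j. weight (Suc j) * z ^ Suc j * u (Suc j)) sums W"
  shows "B = u 0 * (lambert z q - lambert y q) + W"
proof -
  define U where "U = (\<lambda>j. u j * z ^ j)"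
  define T where "T = (\<lambda>j M. \<Sum>m\<le>M. kern_conv j m * z ^ m)"
  define P where "P = (\<lambda>N. \<Sum>m\<le>N. (\<phi> m * z ^ m) * (\<Sum>k\<le>N - m. z ^ k * b k))"
  define V where "V = (\<lambda>j. qpoch_inf z q * weight j)"
  have qz: "qpoch z q n \<noteq> 0" for n
    using z_nz qpoch_inf_split[OF q, of z n] by auto
  \<comment> \<open>The weights tend to a nonzero limit, so dividing the terms of the convergent
    series \<open>W\<close> by them leaves a null sequence.\<close>
  have "U \<longlonglongrightarrow> 0"
  proof -
    have wt: "weight (Suc j) = qpoch q q (Suc (2 * j)) / qpoch z q (2 * Suc j)" for j
      by (simp add: weight_def)
    have "(\<lambda>j. weight (Suc j)) \<longlonglongrightarrow> qpoch_inf q q / qpoch_inf z q"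
      unfolding wt
      by (intro tendsto_divide z_nz filterlim_compose[OF qpoch_tendsto[OF q]])
         (auto intro!: filterlim_subseq strict_monoI)
    moreover have "(\<lambda>j. weight (Suc j) * z ^ Suc j * u (Suc j)) \<longlonglongrightarrow> 0"
      using W by (intro summable_LIMSEQ_zero) (rule sums_summable)
    ultimately have "(\<lambda>j. (weight (Suc j) * z ^ Suc j * u (Suc j)) / weight (Suc j)) \<longlonglongrightarrow>
        0 / (qpoch_inf q q / qpoch_inf z q)"
      by (intro tendsto_divide) (use z_nz qpoch_inf_small_nonzero[OF q q] in auto)
    moreover have "weight (Suc j) \<noteq> 0" for j
      unfolding wt using qz qpoch_base_nonzero[OF q] by simp
    ultimately have "(\<lambda>j. U (Suc j)) \<longlonglongrightarrow> 0"
      by (simp add: U_def mult_ac)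
    thus ?thesis
      by (rule LIMSEQ_imp_Suc)
  qed
  \<comment> \<open>\<open>P\<close> is the Cauchy product with the partial sums of
    \<open>B\<close>; the \<open>\<phi>\<close>-series is absolutely convergent at \<open>z\<close>
    since it converges at \<open>norm z + 1\<close>.\<close>
  have "P \<longlonglongrightarrow> (\<Sum>m. \<phi> m * z ^ m) * B"
    unfolding P_def
  proof (rule convolution_tendsto)
    have "summable (\<lambda>m. \<phi> m * of_real (norm z + 1) ^ m)"
      using qpoch_coeff_sums[OF q] by (rule sums_summable)
    thus "summable (\<lambda>m. norm (\<phi> m * z ^ m))"
      by (rule powser_insidea) (simp add: abs_if)
    show "(\<lambda>N. \<Sum>k\<le>N. z ^ k * b k) \<longlonglongrightarrow> B"
      using B by (simp add: sums_def_le)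
  qed
  hence P1: "P \<longlonglongrightarrow> qpoch_inf z q * B"
    using qpoch_coeff_sums[OF q, of z] by (simp add: sums_iff)
  \<comment> \<open>An exact rearrangement of finite sums: \<open>(x;q)_inf\<close> is now attached
    to the kernel instead of to \<open>b\<close>.\<close>
  have P_eq: "P N = (\<Sum>j\<le>N. U j * T j (N - j))" for N
  proof -
    define F where "F = (\<lambda>m j l. \<phi> m * z ^ m * (kern j l * z ^ l * U j))"
    have "z ^ k * b k = (\<Sum>j\<le>k. kern j (k - j) * z ^ (k - j) * U j)" for k
      unfolding b sum_distrib_left
    proof (intro sum.cong refl)
      fix j assume "j \<in> {..k}"
      hence "z ^ k = z ^ (k - j) * z ^ j"
        by (simp flip: power_add)
      thus "z ^ k * (kern j (k - j) * u j) = kern j (k - j) * z ^ (k - j) * U j"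
        by (simp add: U_def mult_ac)
    qed
    hence "P N = (\<Sum>m\<le>N. \<Sum>k\<le>N - m. \<Sum>j\<le>k. F m j (k - j))"
      by (simp add: P_def F_def sum_distrib_left)
    also have "\<dots> = (\<Sum>j\<le>N. \<Sum>s\<le>N - j. \<Sum>l\<le>s. F (s - l) j l)"
      by (rule sum_triangle_assoc)
    also have "\<dots> = (\<Sum>j\<le>N. U j * T j (N - j))"
      unfolding T_def kern_conv_def sum_distrib_left sum_distrib_right
    proof (intro sum.cong refl)
      fix j s l :: nat assume "l \<in> {..s}"
      hence "z ^ s = z ^ (s - l) * z ^ l"
        by (simp flip: power_add)
      thus "F (s - l) j l = U j * (\<phi> (s - l) * kern j l * z ^ s)"
        by (simp add: F_def mult_ac)
    qed
    finally show ?thesis .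
  qed
  \<comment> \<open>The error is dominated by the convolution of a geometric sequence with the null
    sequence \<open>norm (U j)\<close>.\<close>
  have err: "(\<lambda>N. \<Sum>j\<le>N. U j * (T j (N - j) - V j)) \<longlonglongrightarrow> 0"
  proof -
    obtain C where C: "\<And>j M. norm (T j M - V j) \<le> C * (1 / 2) ^ M"
      unfolding T_def V_def by (rule kern_conv_partial_sums) blast
    have "(\<lambda>N. \<Sum>m\<le>N. (C * (1 / 2) ^ m) * norm (U (N - m))) \<longlonglongrightarrow> (\<Sum>m. C * (1 / 2) ^ m) * norm (0 :: complex)"
    proof (intro convolution_tendsto tendsto_norm \<open>U \<longlonglongrightarrow> 0\<close>)
      show "summable (\<lambda>m. norm (C * (1 / 2) ^ m))"
        unfolding norm_mult norm_power by (intro summable_mult summable_geometric) auto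
    qed
    hence lim: "(\<lambda>N. \<Sum>m\<le>N. (C * (1 / 2) ^ m) * norm (U (N - m))) \<longlonglongrightarrow> 0"
      by simp
    show ?thesis
    proof (rule Lim_null_comparison[OF always_eventually lim], rule allI)
      fix N
      have "norm (\<Sum>j\<le>N. U j * (T j (N - j) - V j)) \<le> (\<Sum>j\<le>N. norm (U j) * (C * (1 / 2) ^ (N - j)))"
        by (rule order_trans[OF norm_sum]) (auto simp: norm_mult intro!: sum_mono mult_left_mono C)
      also have "\<dots> = (\<Sum>m\<le>N. (C * (1 / 2) ^ m) * norm (U (N - m)))"
        by (rule sum.reindex_bij_witness[of _ "\<lambda>m. N - m" "\<lambda>m. N - m"]) auto
      finally show "norm (\<Sum>j\<le>N. U j * (T j (N - j) - V j)) \<le> (\<Sum>m\<le>N. (C * (1 / 2) ^ m) * norm (U (N - m)))" .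
    qed
  qed
  have "(\<lambda>j. U j * V j) sums (qpoch_inf z q * (W + u 0 * weight 0))"
  proof -
    have "(\<lambda>j. qpoch_inf z q * (weight (Suc j) * z ^ Suc j * u (Suc j))) sums (qpoch_inf z q * W)"
      by (intro sums_mult W)
    hence "(\<lambda>j. U (Suc j) * V (Suc j)) sums (qpoch_inf z q * W)"
      by (simp add: U_def V_def mult_ac)
    hence "(\<lambda>j. U j * V j) sums (qpoch_inf z q * W + U 0 * V 0)"
      by (subst (asm) sums_Suc_iff) simp
    thus ?thesis
      by (simp add: U_def V_def algebra_simps)
  qed
  hence "(\<lambda>N. \<Sum>j\<le>N. U j * V j) \<longlonglongrightarrow> qpoch_inf z q * (W + u 0 * weight 0)"
    by (simp add: sums_def_le)
  from tendsto_add[OF err this] have "P \<longlonglongrightarrow> qpoch_inf z q * (W + u 0 * weight 0)"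
    by (simp add: P_eq[abs_def] sum.distrib[symmetric] algebra_simps)
  with P1 have "qpoch_inf z q * B = qpoch_inf z q * (W + u 0 * weight 0)"
    by (rule LIMSEQ_unique)
  thus ?thesis
    using z_nz by (simp add: weight_def)
qed

end

section \<open>Derived WP-Bailey pairs\<close>

lemma tendsto_qpoch:
  assumes "(f \<longlongrightarrow> l) F"
  shows "((\<lambda>k. qpoch (f k) q n) \<longlongrightarrow> qpoch l q n) F"
  unfolding qpoch_def by (intro tendsto_intros assms)

text \<open>Since \<open>n \<ge> 1\<close>, every \<open>qpoch k q (n + j)\<close> contains the
  factor \<open>1 - k\<close>; after division the limit is taken term by term in a finite
  sum.\<close>

lemma derived_beta_eq:
  assumes pair: "\<forall>\<^sub>F k in at 1. wp_bailey_pair q c k (\<lambda>n. \<alpha> n c k) (\<lambda>n. \<beta> n c k)"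
    and derived: "derived_pair_exists \<alpha> \<beta> c" and n: "n \<ge> 1"
  shows "derived_beta \<beta> n c = (\<Sum>j\<le>n. qpoch (1 / c) q (n - j) * qpoch q q (n + j - 1) /
      (qpoch q q (n - j) * qpoch (c * q) q (n + j)) * (if j = 0 then 1 else derived_alpha \<alpha> j c))"
proof -
  \<comment> \<open>Existence of the derived pair concerns indices from 1 on; at index 0 the limit
    is 1 by the normalisation of the pair.\<close>
  have \<alpha>: "((\<lambda>k. \<alpha> j c k) \<longlongrightarrow> (if j = 0 then 1 else derived_alpha \<alpha> j c)) (at 1)" for j
  proof (cases "j = 0")
    case True
    have "\<forall>\<^sub>F k in at 1. 1 = \<alpha> 0 c k"
      using pair by eventually_elim (simp add: wp_bailey_pair_def)
    thus ?thesis
      using True by (auto intro: Lim_transform_eventually)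
  next
    case False
    then obtain l where l: "((\<lambda>k. \<alpha> j c k) \<longlongrightarrow> l) (at 1)"
      using derived unfolding derived_pair_exists_def by (metis One_nat_def Suc_leI neq0_conv)
    thus ?thesis
      using False tendsto_Lim[OF _ l] by (simp add: derived_alpha_def)
  qed
  let ?S = "\<lambda>k. \<Sum>j\<le>n. qpoch (k / c) q (n - j) * qpoch (k * q) q (n + j - 1) /
      (qpoch q q (n - j) * qpoch (c * q) q (n + j)) * \<alpha> j c k"
  have "(?S \<longlongrightarrow> (\<Sum>j\<le>n. qpoch (1 / c) q (n - j) * qpoch (1 * q) q (n + j - 1) /
      (qpoch q q (n - j) * qpoch (c * q) q (n + j)) * (if j = 0 then 1 else derived_alpha \<alpha> j c))) (at 1)"
    unfolding divide_inverse by (intro tendsto_intros tendsto_qpoch \<alpha>)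
  moreover have "\<forall>\<^sub>F k in at 1. ?S k = \<beta> n c k / (1 - k)"
    using pair eventually_neq_at_within[of 1 1 UNIV]
  proof eventually_elim
    case (elim k)
    have "qpoch k q (n + j) = (1 - k) * qpoch (k * q) q (n + j - 1)" for j
      using qpoch_add[of k q 1 "n + j - 1"] n by (simp add: qpoch_Suc)
    hence "\<beta> n c k = (1 - k) * ?S k"
      using elim(1) by (simp add: wp_bailey_pair_def sum_distrib_left mult_ac)
    thus ?case
      using elim(2) by simp
  qed
  ultimately have "((\<lambda>k. \<beta> n c k / (1 - k)) \<longlongrightarrow> (\<Sum>j\<le>n. qpoch (1 / c) q (n - j) * qpoch q q (n + j - 1) /
      (qpoch q q (n - j) * qpoch (c * q) q (n + j)) * (if j = 0 then 1 else derived_alpha \<alpha> j c))) (at 1)"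
    by (simp add: Lim_transform_eventually)
  thus ?thesis
    unfolding derived_beta_def by (intro tendsto_Lim) auto
qed

text \<open>To be used for \<open>d = c\<close> and \<open>d = - c\<close>, for which the first
  Lambert series on the right is the same.\<close>

lemma f2_term_suminf_diff:
  assumes q: "q \<noteq> 0" "norm q < 1" and c: "c \<noteq> 0" and cd: "d\<^sup>2 = c\<^sup>2"
    and z: "qpoch_inf (q * c\<^sup>2) q \<noteq> 0" and y: "qpoch_inf (d * q) q \<noteq> 0"
    and pair: "\<forall>\<^sub>F k in at 1. wp_bailey_pair q d k (\<lambda>n. \<alpha> n d k) (\<lambda>n. \<beta> n d k)"
    and derived: "derived_pair_exists \<alpha> \<beta> d"
    and sum\<beta>: "summable (\<lambda>n. f2_beta_term q \<beta> c d (Suc n))"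
    and sum\<alpha>: "summable (\<lambda>n. f2_alpha_term q \<alpha> c d (Suc n))"
  shows "(\<Sum>n. f2_beta_term q \<beta> c d (Suc n)) - (\<Sum>n. f2_alpha_term q \<alpha> c d (Suc n)) =
    lambert (q * c\<^sup>2) q - lambert (d * q) q"
proof -
  have d: "d \<noteq> 0" using c cd by auto
  interpret q_gauss q "1 / d" "d * q" "q * c\<^sup>2"
  proof
    show "q * c\<^sup>2 * (1 / d) = d * q"
      unfolding cd[symmetric] using d by (simp add: power2_eq_square)
  qed (use q c z y in auto)
  define u where "u = (\<lambda>j. if j = 0 then 1 else derived_alpha \<alpha> j d)"
  \<comment> \<open>The value 0 at \<open>n = 0\<close> matches \<open>kern 0 0 = 0\<close>, so the
    series over \<open>n \<ge> 1\<close> may start at 0.\<close>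
  define b where "b = (\<lambda>n. if n = 0 then 0 else derived_beta \<beta> n d)"
  have zn: "(q * c\<^sup>2) ^ n = c ^ (2 * n) * q ^ n" for n
    by (simp add: power_mult_distrib power_mult)
  have "(\<Sum>n. f2_beta_term q \<beta> c d (Suc n)) =
      u 0 * (lambert (q * c\<^sup>2) q - lambert (d * q) q) + (\<Sum>n. f2_alpha_term q \<alpha> c d (Suc n))"
  proof (rule kern_transform)
    show "b n = (\<Sum>j\<le>n. kern j (n - j) * u j)" for n
    proof (cases "n = 0")
      case True
      thus ?thesis by (simp add: b_def kern_def)
    next
      case False
      hence "b n = (\<Sum>j\<le>n. qpoch (1 / d) q (n - j) * qpoch q q (n + j - 1) /
        (qpoch q q (n - j) * qpoch (d * q) q (n + j)) * u j)"
        unfolding b_def u_def using derived_beta_eq[OF pair derived, of n] by simp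
      also have "\<dots> = (\<Sum>j\<le>n. kern j (n - j) * u j)"
      proof (intro sum.cong refl)
        fix j assume "j \<in> {..n}"
        hence eq: "2 * j + (n - j) = n + j" by simp
        have "\<not> (j = 0 \<and> n - j = 0)"
          using False by auto
        thus "qpoch (1 / d) q (n - j) * qpoch q q (n + j - 1) /
          (qpoch q q (n - j) * qpoch (d * q) q (n + j)) * u j = kern j (n - j) * u j"
          by (simp only: kern_def eq if_False) simp
      qed
      finally show ?thesis .
    qed
    have "(\<lambda>n. (q * c\<^sup>2) ^ Suc n * b (Suc n)) sums (\<Sum>n. f2_beta_term q \<beta> c d (Suc n))"
      using summable_sums[OF sum\<beta>] unfolding zn by (simp add: f2_beta_term_def b_def)
    thus "(\<lambda>n. (q * c\<^sup>2) ^ n * b n) sums (\<Sum>n. f2_beta_term q \<beta> c d (Suc n))"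
      by (subst (asm) sums_Suc_iff) (simp add: b_def)
    show "(\<lambda>j. weight (Suc j) * (q * c\<^sup>2) ^ Suc j * u (Suc j)) sums (\<Sum>n. f2_alpha_term q \<alpha> c d (Suc n))"
      using summable_sums[OF sum\<alpha>] unfolding zn by (simp add: f2_alpha_term_def weight_def u_def mult.assoc)
  qed
  thus ?thesis
    by (simp add: u_def)
qed

text \<open>Subtracting the evaluations for \<open>d = c\<close> and \<open>d = - c\<close> cancels
  \<open>lambert (q * c\<^sup>2) q\<close> and leaves the odd part of the other Lambert
  series.\<close>

lemma f2_eq_odd_lambert:
  assumes q: "q \<noteq> 0" "norm q < 1" and c: "c \<noteq> 0"
    and nonsing: "\<And>n. q * c\<^sup>2 * q ^ n \<noteq> 1"
    and pair: "\<And>d. d \<in> {c, - c} \<Longrightarrow> \<forall>\<^sub>F k in at 1. wp_bailey_pair q d k (\<lambda>n. \<alpha> n d k) (\<lambda>n. \<beta> n d k)"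
    and derived: "\<And>d. d \<in> {c, - c} \<Longrightarrow> derived_pair_exists \<alpha> \<beta> d"
    and conv: "f2_converges q \<alpha> \<beta> c"
  shows "f2 q \<alpha> \<beta> c = - 2 * odd_lambert c q"
proof -
  have z: "qpoch_inf (q * c\<^sup>2) q \<noteq> 0"
    using nonsing by (simp add: qpoch_inf_eq_0_iff[OF q(2)])
  \<comment> \<open>The square equals \<open>q * c\<^sup>2 * q ^ (2 * n + 1)\<close>, so
    \<open>nonsing\<close> also excludes the zeros of \<open>qpoch_inf (d * q) q\<close>.\<close>
  have sq: "(d * q * q ^ n)\<^sup>2 \<noteq> 1" if "d\<^sup>2 = c\<^sup>2" for d n
  proof -
    have "(d * q * q ^ n)\<^sup>2 = q * d\<^sup>2 * q ^ Suc (2 * n)"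
      by (simp add: power2_eq_square mult_2_right power_add mult_ac)
    thus ?thesis
      using nonsing[of "Suc (2 * n)"] that by simp
  qed
  have y: "qpoch_inf (d * q) q \<noteq> 0" if "d\<^sup>2 = c\<^sup>2" for d
    using sq[OF that] by (metis qpoch_inf_eq_0_iff[OF q(2)] power_one)
  have diff: "(\<Sum>n. f2_beta_term q \<beta> c d (Suc n)) - (\<Sum>n. f2_alpha_term q \<alpha> c d (Suc n)) =
    lambert (q * c\<^sup>2) q - lambert (d * q) q" if "d \<in> {c, - c}" for d
  proof -
    have d2: "d\<^sup>2 = c\<^sup>2" using that by auto
    show ?thesis
      using that conv q c z y[OF d2]
      by (intro f2_term_suminf_diff pair derived) (auto simp: f2_converges_def)
  qed
  have "f2 q \<alpha> \<beta> c =
      ((\<Sum>n. f2_beta_term q \<beta> c c (Suc n)) - (\<Sum>n. f2_alpha_term q \<alpha> c c (Suc n))) -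
      ((\<Sum>n. f2_beta_term q \<beta> c (- c) (Suc n)) - (\<Sum>n. f2_alpha_term q \<alpha> c (- c) (Suc n)))"
    by (simp add: f2_def)
  also have "\<dots> = lambert (- c * q) q - lambert (c * q) q"
    by (subst (1 2) diff) auto
  also have "\<dots> = - 2 * odd_lambert c q"
  proof -
    have "(\<lambda>j. - c * q * q ^ j / (1 - (- c * q * q ^ j)) - c * q * q ^ j / (1 - c * q * q ^ j)) sums
        (lambert (- c * q) q - lambert (c * q) q)"
      by (intro sums_diff lambert_sums(1) q y) auto
    moreover have "- c * q * q ^ j / (1 - (- c * q * q ^ j)) - c * q * q ^ j / (1 - c * q * q ^ j) =
        - 2 * (c * q ^ Suc j / (1 - c\<^sup>2 * q ^ (2 * Suc j)))" for j
    proof -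
      define x where "x = c * q * q ^ j"
      have x2: "x\<^sup>2 \<noteq> 1"
        using sq[of c j] by (simp add: x_def)
      hence "1 + x \<noteq> 0" "1 - x \<noteq> 0"
        by (auto simp: power2_eq_1_iff add_eq_0_iff)
      hence "- x / (1 + x) - x / (1 - x) = - 2 * (x / (1 - x\<^sup>2))"
        using x2 by (simp add: field_simps power2_eq_square)
      moreover have "x\<^sup>2 = c\<^sup>2 * q ^ (2 * Suc j)"
        by (simp add: x_def power_mult_distrib power_mult power2_eq_square mult_ac)
      ultimately show ?thesis
        by (simp add: x_def mult_ac)
    qed
    ultimately have "(\<lambda>j. - 2 * (c * q ^ Suc j / (1 - c\<^sup>2 * q ^ (2 * Suc j)))) sums
        (lambert (- c * q) q - lambert (c * q) q)"
      by simp
    moreover have "(\<lambda>j. - 2 * (c * q ^ Suc j / (1 - c\<^sup>2 * q ^ (2 * Suc j)))) sums (- 2 * odd_lambert c q)"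
      unfolding odd_lambert_def using q by (intro sums_mult summable_sums summable_odd_lambert) auto
    ultimately show ?thesis
      by (rule sums_unique2)
  qed
  finally show ?thesis .
qed

text \<open>Positive exponents are covered by the condition at \<open>c\<close>, negative ones by
  that at \<open>1 / c\<close>.\<close>

lemma nonresonant_powi:
  fixes q c :: complex
  assumes "q \<noteq> 0" "c \<noteq> 0" "c\<^sup>2 \<noteq> 1"
    and "\<And>n. q * c\<^sup>2 * q ^ n \<noteq> 1" "\<And>n. q * (1 / c)\<^sup>2 * q ^ n \<noteq> 1"
  shows "c\<^sup>2 * q powi m \<noteq> 1"
proof -
  consider "m = 0" | n where "m = int (Suc n)" | n where "m = - int (Suc n)"
    by (metis int_cases3 gr0_implies_Suc)
  thus ?thesis
  proof cases
    case (2 n)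
    thus ?thesis
      using assms(4)[of n] by (simp only: power_int_of_nat) (simp add: mult_ac)
  next
    case (3 n)
    thus ?thesis
      using assms(1,2) assms(5)[of n]
      by (simp only: power_int_minus power_int_of_nat) (simp add: field_simps)
  qed (use assms(3) in simp)
qed

text \<open>The \<open>nonsingular\<close> conditions keep the denominators on the right and in the
  \<open>\<alpha>\<close>-series away from 0. The pair relation is asked for \<open>k\<close> near
  1, where the derived limits are taken.\<close>

theorem theorem3:
  fixes q a b :: complex and \<alpha> \<beta> :: wp_family
  assumes q: "0 < norm q" "norm q < 1"
    and nonzero: "a \<noteq> 0" "b \<noteq> 0"
    and nonsingular: "a\<^sup>2 \<noteq> 1" "b\<^sup>2 \<noteq> 1"
      "\<And>c n. c \<in> {a, b, 1 / a, 1 / b} \<Longrightarrow> qpoch (q * c\<^sup>2) q (2 * n) \<noteq> 0"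
    and pair: "\<And>c. c \<in> {a, - a, b, - b, 1 / a, - (1 / a), 1 / b, - (1 / b)} \<Longrightarrow>
      \<forall>\<^sub>F k in at 1. wp_bailey_pair q c k (\<lambda>n. \<alpha> n c k) (\<lambda>n. \<beta> n c k)"
    and derived: "\<And>c. c \<in> {a, - a, b, - b, 1 / a, - (1 / a), 1 / b, - (1 / b)} \<Longrightarrow>
      derived_pair_exists \<alpha> \<beta> c"
    and conv: "\<And>c. c \<in> {a, b, 1 / a, 1 / b} \<Longrightarrow> f2_converges q \<alpha> \<beta> c"
  shows "f2 q \<alpha> \<beta> a - f2 q \<alpha> \<beta> b - f2 q \<alpha> \<beta> (1 / a) + f2 q \<alpha> \<beta> (1 / b) =
    2 * (a - b) * (1 + a * b) / ((1 - a\<^sup>2) * (1 - b\<^sup>2))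
    - 2 * a * (qpochs_inf [b / a, q * a / b, - (a * b), - (q / (a * b))] q
               * qpochs_inf [q\<^sup>2, q\<^sup>2] (q\<^sup>2))
        / qpochs_inf [a\<^sup>2, q\<^sup>2 / a\<^sup>2, b\<^sup>2, q\<^sup>2 / b\<^sup>2] (q\<^sup>2)"
proof -
  have q0: "q \<noteq> 0" using q by auto
  \<comment> \<open>The product of length \<open>2 * Suc n\<close> contains the factor with index
    \<open>n\<close>.\<close>
  have ns: "q * c\<^sup>2 * q ^ n \<noteq> 1" if "c \<in> {a, b, 1 / a, 1 / b}" for c n
    using nonsingular(3)[OF that, of "Suc n"] by (auto simp: qpoch_eq_0_iff)
  have f2: "f2 q \<alpha> \<beta> c = - 2 * odd_lambert c q" if "c \<in> {a, b, 1 / a, 1 / b}" for c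
    using that nonzero q q0
    by (intro f2_eq_odd_lambert ns conv pair derived) auto
  have diff: "bilateral_lambert a q - bilateral_lambert b q = theta_quotient a b q"
    using q nonzero nonsingular(1,2) q0
    by (intro bilateral_lambert_diff nonresonant_powi ns) auto
  have tq: "2 * theta_quotient a b q =
      2 * a * (qpochs_inf [b / a, q * a / b, - (a * b), - (q / (a * b))] q * qpochs_inf [q\<^sup>2, q\<^sup>2] (q\<^sup>2))
        / qpochs_inf [a\<^sup>2, q\<^sup>2 / a\<^sup>2, b\<^sup>2, q\<^sup>2 / b\<^sup>2] (q\<^sup>2)"
    by (simp add: theta_quotient_def qtheta_def qpochs_inf_def power2_eq_square mult.assoc)
  \<comment> \<open>Partial fractions, from
    \<open>a (1 - b^2) - b (1 - a^2) = (a - b)(1 + a b)\<close>.\<close>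
  have pf: "2 * (a - b) * (1 + a * b) / ((1 - a\<^sup>2) * (1 - b\<^sup>2)) = 2 * (a / (1 - a\<^sup>2) - b / (1 - b\<^sup>2))"
    using nonsingular(1,2) by (simp add: divide_simps) (simp add: algebra_simps power2_eq_square)
  have "f2 q \<alpha> \<beta> a - f2 q \<alpha> \<beta> b - f2 q \<alpha> \<beta> (1 / a) + f2 q \<alpha> \<beta> (1 / b) =
      - 2 * ((odd_lambert a q - odd_lambert (1 / a) q) - (odd_lambert b q - odd_lambert (1 / b) q))"
    by (simp add: f2)
  also have "\<dots> = 2 * (a / (1 - a\<^sup>2) - b / (1 - b\<^sup>2)) - 2 * theta_quotient a b q"
    by (simp add: diff[symmetric] bilateral_lambert_def algebra_simps)
  finally show ?thesis
    unfolding tq pf .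
qed

end
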